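(* Let $X_1$ and $X_2$ be Banach spaces and let $\alpha_1$ and $\alpha_2$ be isometric automorphisms of $X_1$ and $X_2$, respectively. Then the isometric automorphism $\alpha_1\check\otimes\alpha_2$ of the injective tensor product $X_1\check\otimes X_2$ satisfies $$\mathrm{hc}(\alpha_1\check\otimes\alpha_2)\le\mathrm{hc}(\alpha_1)+\mathrm{hc}(\alpha_2).$$
   Context: All Banach spaces are over $\mathbb{C}$. $X_1\check\otimes X_2$ denotes the (completed) injective Banach space tensor product, and $\alpha_1\check\otimes\alpha_2$ the isometric automorphism determined by $x_1\otimes x_2\mapsto\alpha_1(x_1)\otimes\alpha_2(x_2)$. CA entropy: For a bounded linear map $\gamma:X\to Y$ of Banach spaces, a finite set $\Omega\subseteq X$ and $\delta>0$, let $\mathrm{CA}(\gamma,\Omega,\delta)$ be the collection of triples $(\phi,\psi,d)$ where $d$ is a positive integer and $\phi:X\to\ell_\infty^d$, $\psi:\ell_\infty^d\to Y$ are contractive (norm $\le1$) linear maps with $\|\psi\circ\phi(x)-\gamma(x)\|<\delta$ for all $x\in\Omega$. A CA embedding of $X$ is an isometric linear map $\iota$ from $X$ into a Banach space $Y$ such that $\mathrm{CA}(\iota,\Omega,\delta)\neq\emptyset$ for all finite $\Omega\subseteq X$ and $\delta>0$; every Banach space has one (e.g. the evaluation map $X\to C(B_1(X^* ))$, where $B_1(X^* )$ is the weak$^*$ compact unit ball of the dual). Set $\mathrm{rc}(\Omega,\delta)=\inf\{d:(\phi,\psi,d)\in\mathrm{CA}(\iota,\Omega,\delta)\}$, which does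 not depend on the CA embedding $\iota$. For an isometric (surjective linear) automorphism $\alpha$ of $X$ put $\mathrm{hc}(\alpha,\Omega,\delta)=\limsup_{n\to\infty}\frac1n\log\mathrm{rc}(\Omega\cup\alpha\Omega\cup\cdots\cup\alpha^{n-1}\Omega,\delta)$, $\mathrm{hc}(\alpha,\Omega)=\sup_{\delta>0}\mathrm{hc}(\alpha,\Omega,\delta)$, and $\mathrm{hc}(\alpha)=\sup_\Omega\mathrm{hc}(\alpha,\Omega)$ over finite $\Omega\subseteq X$. *)

theory Defs
  imports "HOL-Analysis.Analysis"
begin

section \<open>Complex Banach spaces\<close>

text \<open>The real structure of the library is kept as the restriction of scalars, so that
  norms, limits and completeness are the library's own.\<close>

class complex_normed_vector = real_normed_vector +
  fixes scaleC :: "complex \<Rightarrow> 'a \<Rightarrow> 'a"  (infixr \<open>*\<^sub>C\<close> 75)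
  assumes scaleC_add_right: "c *\<^sub>C (x + y) = c *\<^sub>C x + c *\<^sub>C y"
    and scaleC_add_left: "(c + d) *\<^sub>C x = c *\<^sub>C x + d *\<^sub>C x"
    and scaleC_scaleC: "c *\<^sub>C (d *\<^sub>C x) = (c * d) *\<^sub>C x"
    and scaleC_of_real: "complex_of_real r *\<^sub>C x = r *\<^sub>R x"
    and norm_scaleC: "norm (c *\<^sub>C x) = cmod c * norm x"

class complex_banach = complex_normed_vector + complete_space

instantiation complex :: complex_banach
begin
definition scaleC_complex :: "complex \<Rightarrow> complex \<Rightarrow> complex"
  where "scaleC_complex c x = c * x"
instance
  by standard (auto simp: scaleC_complex_def algebra_simps norm_mult scaleR_conv_of_real)
end

lemma bounded_linear_scaleC: "bounded_linear (\<lambda>x::'a::complex_normed_vector. c *\<^sub>C x)"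
proof (rule bounded_linear_intro)
  show "c *\<^sub>C (r *\<^sub>R x) = r *\<^sub>R (c *\<^sub>C x)" for r and x :: 'a
    by (simp flip: scaleC_of_real add: scaleC_scaleC mult.commute)
  show "norm (c *\<^sub>C x) \<le> norm x * cmod c" for x :: 'a
    by (simp add: norm_scaleC mult.commute)
qed (rule scaleC_add_right)

lemma bcontfun_scaleC:
  fixes f :: "'a::topological_space \<Rightarrow>\<^sub>C 'b::complex_normed_vector"
  shows "(\<lambda>x. c *\<^sub>C f x) \<in> bcontfun"
proof (rule bcontfun_normI)
  show "continuous_on UNIV (\<lambda>x. c *\<^sub>C f x)"
    by (rule bounded_linear.continuous_on[OF bounded_linear_scaleC]) auto
  show "norm (c *\<^sub>C f x) \<le> cmod c * norm f" for x
    by (simp add: norm_scaleC mult_left_mono norm_bounded)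
qed

instantiation bcontfun :: (topological_space, complex_normed_vector) complex_normed_vector
begin
definition scaleC_bcontfun :: "complex \<Rightarrow> ('a \<Rightarrow>\<^sub>C 'b) \<Rightarrow> ('a \<Rightarrow>\<^sub>C 'b)"
  where "scaleC_bcontfun c f = Bcontfun (\<lambda>x. c *\<^sub>C f x)"

lemma apply_scaleC_bcontfun [simp]:
  "apply_bcontfun (c *\<^sub>C f) x = c *\<^sub>C apply_bcontfun f x"
  for f :: "'a \<Rightarrow>\<^sub>C 'b"
  by (simp add: scaleC_bcontfun_def Bcontfun_inverse bcontfun_scaleC)

instance
proof
  fix c d :: complex and r :: real and f g :: "'a \<Rightarrow>\<^sub>C 'b"
  show "c *\<^sub>C (f + g) = c *\<^sub>C f + c *\<^sub>C g"
    by (rule bcontfun_eqI) (simp add: scaleC_add_right)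
  show "(c + d) *\<^sub>C f = c *\<^sub>C f + d *\<^sub>C f"
    by (rule bcontfun_eqI) (simp add: scaleC_add_left)
  show "c *\<^sub>C (d *\<^sub>C f) = (c * d) *\<^sub>C f"
    by (rule bcontfun_eqI) (simp add: scaleC_scaleC)
  show "complex_of_real r *\<^sub>C f = r *\<^sub>R f"
    by (rule bcontfun_eqI) (simp add: scaleC_of_real)
  have le: "norm (e *\<^sub>C h) \<le> cmod e * norm h" for e and h :: "'a \<Rightarrow>\<^sub>C 'b"
    by (rule norm_bound) (simp add: norm_scaleC mult_left_mono norm_bounded)
  show "norm (c *\<^sub>C f) = cmod c * norm f"
  proof (cases "c = 0")
    case True
    then show ?thesis using le[of c f] by simp
  next
    case False
    have "inverse c *\<^sub>C (c *\<^sub>C f) = f"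
      using False scaleC_of_real[of 1]
      by (intro bcontfun_eqI) (simp add: scaleC_scaleC)
    then have "norm f \<le> cmod (inverse c) * norm (c *\<^sub>C f)"
      using le[of "inverse c" "c *\<^sub>C f"] by simp
    then have "cmod c * norm f \<le> norm (c *\<^sub>C f)"
      using False by (simp add: norm_divide norm_inverse field_simps)
    with le[of c f] show ?thesis by simp
  qed
qed
end

text \<open>The library proves completeness only over metric domains.\<close>

instance bcontfun :: (topological_space, complete_space) complete_space
proof
  fix f :: "nat \<Rightarrow> 'a \<Rightarrow>\<^sub>C 'b"
  assume "Cauchy f"
  then obtain g where "uniform_limit UNIV (\<lambda>n. apply_bcontfun (f n)) g sequentially"
    using uniformly_convergent_eq_cauchy[of "\<lambda>_. True" "\<lambda>n. apply_bcontfun (f n)"]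
    unfolding Cauchy_def uniform_limit_sequentially_iff
    by (metis dist_fun_lt_imp_dist_val_lt)
  from uniform_limit_bcontfunE[OF this sequentially_bot]
  show "convergent f"
    by (metis convergentI)
qed

instance bcontfun :: (topological_space, complex_banach) complex_banach ..

definition clinear_on :: "'a::complex_normed_vector set \<Rightarrow> ('a \<Rightarrow> 'b::complex_normed_vector) \<Rightarrow> bool"
  where "clinear_on S f \<longleftrightarrow>
    (\<forall>x\<in>S. \<forall>y\<in>S. f (x + y) = f x + f y) \<and> (\<forall>c. \<forall>x\<in>S. f (c *\<^sub>C x) = c *\<^sub>C f x)"

abbreviation clinear :: "('a::complex_normed_vector \<Rightarrow> 'b::complex_normed_vector) \<Rightarrow> bool"
  where "clinear \<equiv> clinear_on UNIV"

definition contractive_on :: "'a::complex_normed_vector set \<Rightarrow> ('a \<Rightarrow> 'b::complex_normed_vector) \<Rightarrow> bool"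
  where "contractive_on S f \<longleftrightarrow> clinear_on S f \<and> (\<forall>x\<in>S. norm (f x) \<le> norm x)"

definition isometric_linear :: "('a::complex_normed_vector \<Rightarrow> 'b::complex_normed_vector) \<Rightarrow> bool"
  where "isometric_linear f \<longleftrightarrow> clinear f \<and> (\<forall>x. norm (f x) = norm x)"

definition isometric_automorphism :: "('a::complex_normed_vector \<Rightarrow> 'a) \<Rightarrow> bool"
  where "isometric_automorphism \<alpha> \<longleftrightarrow> isometric_linear \<alpha> \<and> surj \<alpha>"


section \<open>CA embeddings and CA entropy\<close>

text \<open>\<open>\<ell>\<^sub>\<infinity>\<^sup>d\<close> is the subspace of \<open>\<ell>\<^sub>\<infinity>(\<nat>)\<close> (bounded functions on the discrete space \<open>nat\<close>, with
  the supremum norm) of the sequences vanishing from index \<open>d\<close> on. A map out of it is a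
  function on the whole type of which only the restriction to the subspace matters.\<close>

definition ell_inf :: "nat \<Rightarrow> (nat \<Rightarrow>\<^sub>C complex) set"
  where "ell_inf d = {v. \<forall>i\<ge>d. apply_bcontfun v i = 0}"

definition CA :: "('a::complex_banach \<Rightarrow> 'b::complex_banach) \<Rightarrow> 'a set \<Rightarrow> real \<Rightarrow>
    (('a \<Rightarrow> (nat \<Rightarrow>\<^sub>C complex)) \<times> ((nat \<Rightarrow>\<^sub>C complex) \<Rightarrow> 'b) \<times> nat) set"
  where "CA \<gamma> \<Omega> \<delta> = {(\<phi>, \<psi>, d).
    0 < d \<and> range \<phi> \<subseteq> ell_inf d \<and> contractive_on UNIV \<phi> \<and> contractive_on (ell_inf d) \<psi> \<and>
    (\<forall>x\<in>\<Omega>. norm (\<psi> (\<phi> x) - \<gamma> x) < \<delta>)}"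

definition CA_embedding :: "('a::complex_banach \<Rightarrow> 'b::complex_banach) \<Rightarrow> bool"
  where "CA_embedding \<iota> \<longleftrightarrow> isometric_linear \<iota> \<and> (\<forall>\<Omega> \<delta>. finite \<Omega> \<longrightarrow> \<delta> > 0 \<longrightarrow> CA \<iota> \<Omega> \<delta> \<noteq> {})"

text \<open>The quantities below take the CA embedding \<open>\<iota>\<close> as an argument; mathematically they are
  independent of it. For a CA embedding, finite \<open>\<Omega>\<close> and \<open>\<delta> > 0\<close> the infimum is over a
  nonempty set of positive integers.\<close>

definition rc :: "('a::complex_banach \<Rightarrow> 'b::complex_banach) \<Rightarrow> 'a set \<Rightarrow> real \<Rightarrow> nat"
  where "rc \<iota> \<Omega> \<delta> = Inf {d. \<exists>\<phi> \<psi>. (\<phi>, \<psi>, d) \<in> CA \<iota> \<Omega> \<delta>}"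

definition hc_set_tol :: "('a::complex_banach \<Rightarrow> 'b::complex_banach) \<Rightarrow> ('a \<Rightarrow> 'a) \<Rightarrow> 'a set \<Rightarrow> real \<Rightarrow> ereal"
  where "hc_set_tol \<iota> \<alpha> \<Omega> \<delta> =
    limsup (\<lambda>n. ereal (1 / real n * ln (real (rc \<iota> (\<Union>k<n. (\<alpha> ^^ k) ` \<Omega>) \<delta>))))"

definition hc_set :: "('a::complex_banach \<Rightarrow> 'b::complex_banach) \<Rightarrow> ('a \<Rightarrow> 'a) \<Rightarrow> 'a set \<Rightarrow> ereal"
  where "hc_set \<iota> \<alpha> \<Omega> = (SUP \<delta>\<in>{0<..}. hc_set_tol \<iota> \<alpha> \<Omega> \<delta>)"

definition hc :: "('a::complex_banach \<Rightarrow> 'b::complex_banach) \<Rightarrow> ('a \<Rightarrow> 'a) \<Rightarrow> ereal"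
  where "hc \<iota> \<alpha> = (SUP \<Omega>\<in>Collect finite. hc_set \<iota> \<alpha> \<Omega>)"


section \<open>The injective tensor product\<close>

subsection \<open>The dual unit ball with the weak* topology\<close>

typedef (overloaded) 'a dual_ball =
  "{f :: 'a::complex_normed_vector \<Rightarrow> complex. contractive_on UNIV f}"
  morphisms dual_apply Dual
  by (rule exI[of _ "\<lambda>_. 0"]) (auto simp: contractive_on_def clinear_on_def scaleC_complex_def)

text \<open>The weak* topology is the one induced by the product topology on functions.\<close>

instantiation dual_ball :: (complex_normed_vector) topological_space
begin
definition open_dual_ball :: "'a dual_ball set \<Rightarrow> bool"
  where "open_dual_ball U \<longleftrightarrow> (\<exists>V. open V \<and> U = dual_apply -` V)"
instance
proof
  show "open (UNIV :: 'a dual_ball set)"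
    unfolding open_dual_ball_def by (intro exI[of _ UNIV]) auto
  show "open (S \<inter> T)" if "open S" "open T" for S T :: "'a dual_ball set"
    using that unfolding open_dual_ball_def by (metis open_Int vimage_Int)
  show "open (\<Union>K)" if K: "\<forall>S\<in>K. open S" for K :: "'a dual_ball set set"
  proof -
    from K obtain V where V: "\<And>S. S \<in> K \<Longrightarrow> open (V S) \<and> S = dual_apply -` V S"
      unfolding open_dual_ball_def by metis
    then have "\<Union>K = dual_apply -` (\<Union>S\<in>K. V S)" by blast
    moreover have "open (\<Union>S\<in>K. V S)" using V by blast
    ultimately show ?thesis unfolding open_dual_ball_def by blast
  qed
qed
end

lemma dual_apply_contractive: "contractive_on UNIV (dual_apply f)"
  using dual_apply[of f] by simp

lemma norm_dual_apply_le: "cmod (dual_apply f x) \<le> norm x"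
  using dual_apply_contractive[of f] by (simp add: contractive_on_def)

lemma dual_apply_add: "dual_apply f (x + y) = dual_apply f x + dual_apply f y"
  using dual_apply_contractive[of f] by (simp add: contractive_on_def clinear_on_def)

lemma dual_apply_scaleC: "dual_apply f (c *\<^sub>C x) = c * dual_apply f x"
  using dual_apply_contractive[of f]
  by (simp add: contractive_on_def clinear_on_def scaleC_complex_def)

lemma continuous_dual_apply: "continuous_on UNIV (\<lambda>f. dual_apply f x)"
proof -
  have "continuous_on UNIV (dual_apply :: 'a dual_ball \<Rightarrow> _)"
    unfolding continuous_on_open_vimage[OF open_UNIV] open_dual_ball_def by auto
  from continuous_on_compose2[OF continuous_on_product_coordinates[of x] this]
  show ?thesis by simp
qed

subsection \<open>Elementary tensors and the completion\<close>

text \<open>A finite sum of elementary tensors is identified with the function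
  \<open>(f, g) \<mapsto> \<Sum> f(x\<^sub>i) g(y\<^sub>i)\<close> on the product of the dual unit balls. Its supremum is by
  definition the injective norm, so the completion of the algebraic tensor product in the
  injective norm is the closure of these functions.\<close>

definition etensor :: "'a::complex_banach \<Rightarrow> 'b::complex_banach \<Rightarrow> ('a dual_ball \<times> 'b dual_ball) \<Rightarrow>\<^sub>C complex"
  where "etensor x y = Bcontfun (\<lambda>(f, g). dual_apply f x * dual_apply g y)"

lemma etensor_apply [simp]:
  "apply_bcontfun (etensor x y) p = dual_apply (fst p) x * dual_apply (snd p) y"
proof -
  have "(\<lambda>(f, g). dual_apply f x * dual_apply g y) \<in> bcontfun"
  proof (rule bcontfun_normI)
    show "continuous_on UNIV (\<lambda>(f, g). dual_apply f x * dual_apply g y)"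
      unfolding case_prod_unfold
      by (intro continuous_on_mult continuous_on_compose2[OF continuous_dual_apply]
          continuous_on_fst continuous_on_snd continuous_on_id) auto
    show "cmod (case p of (f, g) \<Rightarrow> dual_apply f x * dual_apply g y) \<le> norm x * norm y" for p
      by (auto simp: norm_mult case_prod_unfold intro!: mult_mono norm_dual_apply_le)
  qed
  then show ?thesis
    by (simp add: etensor_def Bcontfun_inverse case_prod_unfold)
qed

definition algebraic_tensors :: "(('a::complex_banach dual_ball \<times> 'b::complex_banach dual_ball) \<Rightarrow>\<^sub>C complex) set"
  where "algebraic_tensors = range (\<lambda>ps. \<Sum>(x, y)\<leftarrow>ps. etensor x y)"

lemma algebraic_tensors_0: "0 \<in> algebraic_tensors"
  unfolding algebraic_tensors_def by (rule range_eqI[of _ _ "[]"]) simp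

lemma algebraic_tensors_add:
  assumes "u \<in> algebraic_tensors" "v \<in> algebraic_tensors"
  shows "u + v \<in> algebraic_tensors"
proof -
  from assms obtain ps qs where
    "u = (\<Sum>(x, y)\<leftarrow>ps. etensor x y)" "v = (\<Sum>(x, y)\<leftarrow>qs. etensor x y)"
    by (auto simp: algebraic_tensors_def)
  then show ?thesis
    unfolding algebraic_tensors_def by (intro range_eqI[of _ _ "ps @ qs"]) simp
qed

lemma etensor_scaleC: "c *\<^sub>C etensor x y = etensor (c *\<^sub>C x) y"
  by (rule bcontfun_eqI) (simp add: dual_apply_scaleC scaleC_complex_def)

lemma scaleC_zero_right [simp]: "c *\<^sub>C (0::'a::complex_normed_vector) = 0"
  using scaleC_add_right[of c 0 0] by simp

lemma algebraic_tensors_scaleC: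
  assumes "u \<in> algebraic_tensors"
  shows "c *\<^sub>C u \<in> algebraic_tensors"
proof -
  have "c *\<^sub>C (\<Sum>(x, y)\<leftarrow>ps. etensor x y) = (\<Sum>(x, y)\<leftarrow>map (\<lambda>(x, y). (c *\<^sub>C x, y)) ps. etensor x y)"
    for ps :: "('a \<times> 'b) list"
    by (induction ps) (auto simp: scaleC_add_right etensor_scaleC)
  with assms show ?thesis
    unfolding algebraic_tensors_def by (metis (no_types, lifting) imageE rangeI)
qed

lemma closure_algebraic_tensors_add:
  assumes "u \<in> closure algebraic_tensors" "v \<in> closure algebraic_tensors"
  shows "u + v \<in> closure algebraic_tensors"
proof -
  from assms obtain a b where "\<forall>n. a n \<in> algebraic_tensors" "a \<longlonglongrightarrow> u"
    "\<forall>n. b n \<in> algebraic_tensors" "b \<longlonglongrightarrow> v"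
    unfolding closure_sequential by blast
  then show ?thesis
    unfolding closure_sequential
    by (intro exI[of _ "\<lambda>n. a n + b n"]) (auto intro: algebraic_tensors_add tendsto_add)
qed

lemma closure_algebraic_tensors_scaleC:
  assumes "u \<in> closure algebraic_tensors"
  shows "c *\<^sub>C u \<in> closure algebraic_tensors"
proof -
  from assms obtain a where "\<forall>n. a n \<in> algebraic_tensors" "a \<longlonglongrightarrow> u"
    unfolding closure_sequential by blast
  then show ?thesis
    unfolding closure_sequential
    by (intro exI[of _ "\<lambda>n. c *\<^sub>C a n"])
      (auto intro: algebraic_tensors_scaleC bounded_linear.tendsto[OF bounded_linear_scaleC])
qed

typedef (overloaded) ('a, 'b) injective_tensor =
  "closure (algebraic_tensors :: (('a::complex_banach dual_ball \<times> 'b::complex_banach dual_ball) \<Rightarrow>\<^sub>C complex) set)"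
  morphisms tensor_fun Tensor
  using algebraic_tensors_0 closure_subset by blast

setup_lifting type_definition_injective_tensor

instantiation injective_tensor :: (complex_banach, complex_banach) real_vector
begin

lift_definition zero_injective_tensor :: "('a, 'b) injective_tensor" is 0
  using algebraic_tensors_0 closure_subset by blast

lift_definition plus_injective_tensor ::
  "('a, 'b) injective_tensor \<Rightarrow> ('a, 'b) injective_tensor \<Rightarrow> ('a, 'b) injective_tensor" is "(+)"
  by (rule closure_algebraic_tensors_add)

lift_definition scaleR_injective_tensor ::
  "real \<Rightarrow> ('a, 'b) injective_tensor \<Rightarrow> ('a, 'b) injective_tensor" is scaleR
  by (metis closure_algebraic_tensors_scaleC scaleC_of_real)

lift_definition uminus_injective_tensor ::
  "('a, 'b) injective_tensor \<Rightarrow> ('a, 'b) injective_tensor" is uminus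
  by (metis closure_algebraic_tensors_scaleC scaleC_of_real scaleR_minus1_left)

lift_definition minus_injective_tensor ::
  "('a, 'b) injective_tensor \<Rightarrow> ('a, 'b) injective_tensor \<Rightarrow> ('a, 'b) injective_tensor" is "(-)"
  by (metis closure_algebraic_tensors_add closure_algebraic_tensors_scaleC scaleC_of_real
      scaleR_minus1_left diff_conv_add_uminus)

instance
proof
  fix u v w :: "('a, 'b) injective_tensor" and r s :: real
  show "u + v + w = u + (v + w)" by transfer (rule add.assoc)
  show "u + v = v + u" by transfer (rule add.commute)
  show "0 + u = u" by transfer simp
  show "- u + u = 0" by transfer simp
  show "u - v = u + - v" by transfer simp
  show "r *\<^sub>R (u + v) = r *\<^sub>R u + r *\<^sub>R v" by transfer (rule scaleR_add_right)
  show "(r + s) *\<^sub>R u = r *\<^sub>R u + s *\<^sub>R u" by transfer (rule scaleR_add_left)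
  show "r *\<^sub>R s *\<^sub>R u = (r * s) *\<^sub>R u" by transfer simp
  show "1 *\<^sub>R u = u" by transfer simp
qed

end

instantiation injective_tensor :: (complex_banach, complex_banach) complex_normed_vector
begin

lift_definition scaleC_injective_tensor ::
  "complex \<Rightarrow> ('a, 'b) injective_tensor \<Rightarrow> ('a, 'b) injective_tensor" is scaleC
  by (rule closure_algebraic_tensors_scaleC)

lift_definition norm_injective_tensor :: "('a, 'b) injective_tensor \<Rightarrow> real" is norm .

lift_definition dist_injective_tensor ::
  "('a, 'b) injective_tensor \<Rightarrow> ('a, 'b) injective_tensor \<Rightarrow> real" is dist .

lift_definition sgn_injective_tensor :: "('a, 'b) injective_tensor \<Rightarrow> ('a, 'b) injective_tensor"
  is "\<lambda>u. u /\<^sub>R norm u"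
  by (metis closure_algebraic_tensors_scaleC scaleC_of_real)

definition uniformity_injective_tensor ::
  "(('a, 'b) injective_tensor \<times> ('a, 'b) injective_tensor) filter"
  where "uniformity_injective_tensor = (INF e\<in>{0 <..}. principal {(x, y). dist x y < e})"

definition open_injective_tensor :: "('a, 'b) injective_tensor set \<Rightarrow> bool"
  where "open_injective_tensor S = (\<forall>x\<in>S. \<forall>\<^sub>F (x', y) in uniformity. x' = x \<longrightarrow> y \<in> S)"

instance
proof
  fix u v :: "('a, 'b) injective_tensor" and r :: real and c d :: complex
  show "dist u v = norm (u - v)" by transfer (rule dist_norm)
  show "sgn u = u /\<^sub>R norm u" by transfer (rule refl)
  show "norm u = 0 \<longleftrightarrow> u = 0" by transfer simp
  show "norm (u + v) \<le> norm u + norm v" by transfer (rule norm_triangle_ineq)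
  show "norm (r *\<^sub>R u) = \<bar>r\<bar> * norm u" by transfer simp
  show "c *\<^sub>C (u + v) = c *\<^sub>C u + c *\<^sub>C v" by transfer (rule scaleC_add_right)
  show "(c + d) *\<^sub>C u = c *\<^sub>C u + d *\<^sub>C u" by transfer (rule scaleC_add_left)
  show "c *\<^sub>C d *\<^sub>C u = (c * d) *\<^sub>C u" by transfer (rule scaleC_scaleC)
  show "complex_of_real r *\<^sub>C u = r *\<^sub>R u" by transfer (rule scaleC_of_real)
  show "norm (c *\<^sub>C u) = cmod c * norm u" by transfer (rule norm_scaleC)
qed (rule open_injective_tensor_def uniformity_injective_tensor_def)+

end

instance injective_tensor :: (complex_banach, complex_banach) complex_banach
proof
  fix U :: "nat \<Rightarrow> ('a, 'b) injective_tensor"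
  assume U: "Cauchy U"
  then have "Cauchy (\<lambda>n. tensor_fun (U n))"
    unfolding Cauchy_def dist_injective_tensor.rep_eq .
  then obtain l where l: "(\<lambda>n. tensor_fun (U n)) \<longlonglongrightarrow> l"
    using Cauchy_convergent convergent_def by blast
  then have "l \<in> closure algebraic_tensors"
    by (rule closed_sequentially[OF closed_closure, rotated]) (rule tensor_fun)
  then have "tensor_fun (Tensor l) = l" by (rule Tensor_inverse)
  with l have "U \<longlonglongrightarrow> Tensor l"
    unfolding tendsto_iff dist_injective_tensor.rep_eq by simp
  then show "convergent U" by (rule convergentI)
qed

lift_definition tensor :: "'a::complex_banach \<Rightarrow> 'b::complex_banach \<Rightarrow> ('a, 'b) injective_tensor"
  (infixr \<open>\<otimes>\<^sub>i\<close> 70) is etensor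
proof -
  fix x :: 'a and y :: 'b
  have "etensor x y \<in> algebraic_tensors"
    unfolding algebraic_tensors_def by (rule range_eqI[of _ _ "[(x, y)]"]) simp
  then show "etensor x y \<in> closure algebraic_tensors"
    using closure_subset by blast
qed

text \<open>The following facts are the defining properties of the injective tensor product.\<close>

lemma tensor_add_left: "(x + x') \<otimes>\<^sub>i y = x \<otimes>\<^sub>i y + x' \<otimes>\<^sub>i y"
  by transfer (rule bcontfun_eqI, simp add: dual_apply_add algebra_simps)

lemma tensor_add_right: "x \<otimes>\<^sub>i (y + y') = x \<otimes>\<^sub>i y + x \<otimes>\<^sub>i y'"
  by transfer (rule bcontfun_eqI, simp add: dual_apply_add algebra_simps)

lemma tensor_scaleC_left: "(c *\<^sub>C x) \<otimes>\<^sub>i y = c *\<^sub>C (x \<otimes>\<^sub>i y)"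
  by transfer (rule bcontfun_eqI, simp add: dual_apply_scaleC scaleC_complex_def)

lemma tensor_scaleC_right: "x \<otimes>\<^sub>i (c *\<^sub>C y) = c *\<^sub>C (x \<otimes>\<^sub>i y)"
  by transfer (rule bcontfun_eqI, simp add: dual_apply_scaleC scaleC_complex_def)

lemma tensor_fun_sum_list:
  "tensor_fun (\<Sum>(x, y)\<leftarrow>ps. x \<otimes>\<^sub>i y) = (\<Sum>(x, y)\<leftarrow>ps. etensor x y)"
  by (induction ps) (auto simp: plus_injective_tensor.rep_eq zero_injective_tensor.rep_eq tensor.rep_eq)

lemma apply_sum_etensor:
  "apply_bcontfun (\<Sum>(x, y)\<leftarrow>ps. etensor x y) (f, g) = (\<Sum>(x, y)\<leftarrow>ps. dual_apply f x * dual_apply g y)"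
  by (induction ps) auto

lemma norm_bcontfun_SUP:
  fixes u :: "'a::topological_space \<Rightarrow>\<^sub>C 'b::real_normed_vector"
  shows "norm u = (SUP p. norm (apply_bcontfun u p))"
proof (rule antisym)
  have "bdd_above (range (\<lambda>p. norm (apply_bcontfun u p)))"
    by (rule bdd_aboveI2[of _ _ "norm u"]) (rule norm_bounded)
  then show "norm u \<le> (SUP p. norm (apply_bcontfun u p))"
    by (intro norm_bound cSUP_upper) auto
  show "(SUP p. norm (apply_bcontfun u p)) \<le> norm u"
    by (rule cSUP_least) (auto intro: norm_bounded)
qed

lemma injective_norm:
  "norm (\<Sum>(x, y)\<leftarrow>ps. x \<otimes>\<^sub>i y) =
    (SUP (f, g). cmod (\<Sum>(x, y)\<leftarrow>ps. dual_apply f x * dual_apply g y))"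
  unfolding norm_injective_tensor.rep_eq tensor_fun_sum_list norm_bcontfun_SUP
  by (rule SUP_cong[OF refl]) (simp only: apply_sum_etensor split_paired_all prod.case)

lemma tensor_dense:
  "closure (range (\<lambda>ps. \<Sum>(x, y)\<leftarrow>ps. x \<otimes>\<^sub>i y)) = (UNIV :: ('a::complex_banach, 'b::complex_banach) injective_tensor set)"
proof -
  have "\<exists>v\<in>range (\<lambda>ps. \<Sum>(x, y)\<leftarrow>ps. x \<otimes>\<^sub>i y). dist v u < e"
    if "e > 0" for u :: "('a, 'b) injective_tensor" and e
  proof -
    have "\<exists>a\<in>algebraic_tensors. dist a (tensor_fun u) < e"
      using tensor_fun[of u] that unfolding closure_approachable by blast
    then obtain ps where "dist (\<Sum>(x, y)\<leftarrow>ps. etensor x y) (tensor_fun u) < e"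
      unfolding algebraic_tensors_def by blast
    then show ?thesis
      by (auto simp: dist_injective_tensor.rep_eq tensor_fun_sum_list)
  qed
  then show ?thesis
    by (auto simp: closure_approachable)
qed

definition tensor_automorphism ::
  "('a::complex_banach \<Rightarrow> 'a) \<Rightarrow> ('b::complex_banach \<Rightarrow> 'b) \<Rightarrow>
    ('a, 'b) injective_tensor \<Rightarrow> ('a, 'b) injective_tensor"
  where "tensor_automorphism \<alpha>\<^sub>1 \<alpha>\<^sub>2 =
    (THE \<beta>. isometric_automorphism \<beta> \<and> (\<forall>x y. \<beta> (x \<otimes>\<^sub>i y) = \<alpha>\<^sub>1 x \<otimes>\<^sub>i \<alpha>\<^sub>2 y))"

text \<open>The description in \<open>tensor_automorphism\<close> does determine a unique map.\<close>

definition dual_pull :: "('a::complex_banach \<Rightarrow> 'a) \<Rightarrow> 'a dual_ball \<Rightarrow> 'a dual_ball"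
  where "dual_pull \<alpha> f = Dual (\<lambda>x. dual_apply f (\<alpha> x))"

lemma dual_pull_apply:
  assumes "contractive_on UNIV \<alpha>"
  shows "dual_apply (dual_pull \<alpha> f) x = dual_apply f (\<alpha> x)"
proof -
  have "cmod (dual_apply f (\<alpha> z)) \<le> norm z" for z
    using assms norm_dual_apply_le[of f "\<alpha> z"] order_trans
    unfolding contractive_on_def by blast
  then have "contractive_on UNIV (\<lambda>x. dual_apply f (\<alpha> x))"
    using assms
    by (auto simp: contractive_on_def clinear_on_def dual_apply_add dual_apply_scaleC scaleC_complex_def)
  then show ?thesis
    by (simp add: dual_pull_def Dual_inverse)
qed

lemma continuous_dual_pull:
  assumes "contractive_on UNIV \<alpha>"
  shows "continuous_on UNIV (dual_pull \<alpha>)"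
proof -
  have "continuous_on UNIV (\<lambda>f x. dual_apply f (\<alpha> x))"
    by (intro continuous_on_coordinatewise_then_product continuous_dual_apply)
  moreover have "(\<lambda>f. dual_apply (dual_pull \<alpha> f)) = (\<lambda>f x. dual_apply f (\<alpha> x))"
    using dual_pull_apply[OF assms] by auto
  ultimately have c: "continuous_on UNIV (\<lambda>f. dual_apply (dual_pull \<alpha> f))"
    by (rule subst[where P = "continuous_on UNIV", OF sym, rotated])
  show ?thesis
    unfolding continuous_on_open_vimage[OF open_UNIV]
  proof safe
    fix U :: "'a dual_ball set"
    assume "open U"
    then obtain V where V: "open V" "U = dual_apply -` V"
      unfolding open_dual_ball_def by blast
    then have "open ((\<lambda>f. dual_apply (dual_pull \<alpha> f)) -` V)"
      using open_vimage[OF V(1) c] by simp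
    then show "open (dual_pull \<alpha> -` U \<inter> UNIV)"
      by (simp add: V vimage_def)
  qed
qed

lemma tensor_map_exists:
  fixes \<alpha>\<^sub>1 :: "'a::complex_banach \<Rightarrow> 'a" and \<alpha>\<^sub>2 :: "'b::complex_banach \<Rightarrow> 'b"
  assumes c: "contractive_on UNIV \<alpha>\<^sub>1" "contractive_on UNIV \<alpha>\<^sub>2"
  shows "\<exists>\<beta>. contractive_on UNIV \<beta> \<and> (\<forall>x y. \<beta> (x \<otimes>\<^sub>i y) = \<alpha>\<^sub>1 x \<otimes>\<^sub>i \<alpha>\<^sub>2 y)"
proof -
  define P where "P = (\<lambda>p. (dual_pull \<alpha>\<^sub>1 (fst p), dual_pull \<alpha>\<^sub>2 (snd p)))"
  have contP: "continuous_on UNIV P"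
    unfolding P_def
    by (intro continuous_on_Pair continuous_on_compose2[OF continuous_dual_pull[OF c(1)]]
        continuous_on_compose2[OF continuous_dual_pull[OF c(2)]]
        continuous_on_fst continuous_on_snd continuous_on_id) auto
  define T where "T = (\<lambda>u :: ('a dual_ball \<times> 'b dual_ball) \<Rightarrow>\<^sub>C complex. Bcontfun (\<lambda>p. u (P p)))"
  have T: "apply_bcontfun (T u) p = apply_bcontfun u (P p)" for u p
  proof -
    have "(\<lambda>p. apply_bcontfun u (P p)) \<in> bcontfun"
      by (rule bcontfun_normI[of _ "norm u"])
        (auto intro: norm_bounded continuous_on_compose2[OF _ contP])
    then show ?thesis by (simp add: T_def Bcontfun_inverse)
  qed
  have add: "T (u + v) = T u + T v" and scale: "T (a *\<^sub>C u) = a *\<^sub>C T u" and zero: "T 0 = 0"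
    for u v a
    by (rule bcontfun_eqI; simp add: T)+
  have nrm: "norm (T u) \<le> norm u" for u
    by (rule norm_bound) (simp add: T norm_bounded)
  have elem: "T (etensor x y) = etensor (\<alpha>\<^sub>1 x) (\<alpha>\<^sub>2 y)" for x y
    by (rule bcontfun_eqI) (simp add: T P_def dual_pull_apply[OF c(1)] dual_pull_apply[OF c(2)])
  have alg: "T (\<Sum>(x, y)\<leftarrow>ps. etensor x y) =
      (\<Sum>(x, y)\<leftarrow>map (\<lambda>(x, y). (\<alpha>\<^sub>1 x, \<alpha>\<^sub>2 y)) ps. etensor x y)" for ps
    by (induction ps) (auto simp: add zero elem)
  have "bounded_linear T"
  proof (rule bounded_linear_intro[of _ 1])
    show "T (r *\<^sub>R u) = r *\<^sub>R T u" for r u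
      using scale[of "complex_of_real r" u] by (simp add: scaleC_of_real)
  qed (simp_all add: add nrm)
  then have "T ` closure algebraic_tensors \<subseteq> closure (T ` algebraic_tensors)"
    by (rule closure_bounded_linear_image_subset)
  also have "\<dots> \<subseteq> closure algebraic_tensors"
    unfolding algebraic_tensors_def
    by (rule closure_mono) (auto simp only: alg intro: rangeI)
  finally have cl: "T (tensor_fun u) \<in> closure algebraic_tensors" for u
    using tensor_fun by blast
  define \<beta> where "\<beta> = (\<lambda>u. Tensor (T (tensor_fun u)))"
  have \<beta>: "tensor_fun (\<beta> u) = T (tensor_fun u)" for u
    by (simp add: \<beta>_def Tensor_inverse cl)
  have "contractive_on UNIV \<beta>"
    unfolding contractive_on_def clinear_on_def
    by (auto simp: tensor_fun_inject[symmetric] \<beta> plus_injective_tensor.rep_eq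
        scaleC_injective_tensor.rep_eq norm_injective_tensor.rep_eq add scale nrm)
  moreover have "\<beta> (x \<otimes>\<^sub>i y) = \<alpha>\<^sub>1 x \<otimes>\<^sub>i \<alpha>\<^sub>2 y" for x y
    by (simp add: tensor_fun_inject[symmetric] \<beta> tensor.rep_eq elem)
  ultimately show ?thesis by blast
qed

lemma contractive_eq_on_tensors:
  fixes \<beta> \<beta>' :: "('a::complex_banach, 'b::complex_banach) injective_tensor \<Rightarrow> 'c::complex_normed_vector"
  assumes c: "contractive_on UNIV \<beta>" "contractive_on UNIV \<beta>'"
    and eq: "\<And>x y. \<beta> (x \<otimes>\<^sub>i y) = \<beta>' (x \<otimes>\<^sub>i y)"
  shows "\<beta> = \<beta>'"
proof -
  have bl: "bounded_linear f" if "contractive_on UNIV f"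
    for f :: "('a, 'b) injective_tensor \<Rightarrow> 'c"
  proof (rule bounded_linear_intro[of _ 1])
    show "f (r *\<^sub>R x) = r *\<^sub>R f x" for r x
      using that unfolding contractive_on_def clinear_on_def
      by (metis UNIV_I scaleC_of_real)
  qed (use that in \<open>auto simp: contractive_on_def clinear_on_def\<close>)
  interpret b: bounded_linear \<beta> using bl c(1) .
  interpret b': bounded_linear \<beta>' using bl c(2) .
  have "\<beta> (\<Sum>(x, y)\<leftarrow>ps. x \<otimes>\<^sub>i y) = \<beta>' (\<Sum>(x, y)\<leftarrow>ps. x \<otimes>\<^sub>i y)" for ps
    by (induction ps) (auto simp: b.zero b'.zero b.add b'.add eq)
  then have "range (\<lambda>ps. \<Sum>(x, y)\<leftarrow>ps. x \<otimes>\<^sub>i y) \<subseteq> {u. \<beta> u = \<beta>' u}"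
    by auto
  moreover have "closed {u. \<beta> u = \<beta>' u}"
    by (intro closed_Collect_eq bounded_linear.continuous_on[OF bl[OF c(1)]]
        bounded_linear.continuous_on[OF bl[OF c(2)]] continuous_on_id)
  ultimately have "closure (range (\<lambda>ps. \<Sum>(x, y)\<leftarrow>ps. x \<otimes>\<^sub>i y)) \<subseteq> {u. \<beta> u = \<beta>' u}"
    by (rule closure_minimal)
  then show ?thesis
    unfolding tensor_dense by auto
qed

lemma isometric_automorphism_imp_contractive:
  "isometric_automorphism \<alpha> \<Longrightarrow> contractive_on UNIV \<alpha>"
  by (simp add: isometric_automorphism_def isometric_linear_def contractive_on_def)

lemma isometric_automorphism_inverse:
  assumes "isometric_automorphism \<alpha>"
  shows "contractive_on UNIV (inv \<alpha>)" and "\<alpha> (inv \<alpha> x) = x" and "inv \<alpha> (\<alpha> x) = x"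
proof -
  have add: "\<alpha> (x + y) = \<alpha> x + \<alpha> y" and scale: "\<alpha> (c *\<^sub>C x) = c *\<^sub>C \<alpha> x"
    and nrm: "norm (\<alpha> x) = norm x" and surj: "surj \<alpha>" for x y c
    using assms by (auto simp: isometric_automorphism_def isometric_linear_def clinear_on_def)
  have inj: "x = y" if "\<alpha> x = \<alpha> y" for x y
  proof -
    have "\<alpha> (x - y) + \<alpha> y = \<alpha> x"
      using add[of "x - y" y] by simp
    then have "norm (x - y) = 0"
      using that nrm[of "x - y"] by simp
    then show ?thesis by simp
  qed
  show r: "\<alpha> (inv \<alpha> x) = x" for x
    using surj by (rule surj_f_inv_f)
  show "inv \<alpha> (\<alpha> x) = x"
    by (rule inj) (rule r)
  have "inv \<alpha> (x + y) = inv \<alpha> x + inv \<alpha> y" "inv \<alpha> (c *\<^sub>C x) = c *\<^sub>C inv \<alpha> x" for x y c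
    by (rule inj, simp add: add scale r)+
  moreover have "norm (inv \<alpha> x) = norm x" for x
    using nrm[of "inv \<alpha> x"] r by simp
  ultimately show "contractive_on UNIV (inv \<alpha>)"
    by (simp add: contractive_on_def clinear_on_def)
qed

lemma ex1_tensor_automorphism:
  fixes \<alpha>\<^sub>1 :: "'a::complex_banach \<Rightarrow> 'a" and \<alpha>\<^sub>2 :: "'b::complex_banach \<Rightarrow> 'b"
  assumes a: "isometric_automorphism \<alpha>\<^sub>1" "isometric_automorphism \<alpha>\<^sub>2"
  shows "\<exists>!\<beta>. isometric_automorphism \<beta> \<and> (\<forall>x y. \<beta> (x \<otimes>\<^sub>i y) = \<alpha>\<^sub>1 x \<otimes>\<^sub>i \<alpha>\<^sub>2 y)"
proof -
  note i1 = isometric_automorphism_inverse[OF a(1)]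
  note i2 = isometric_automorphism_inverse[OF a(2)]
  obtain \<beta> where \<beta>: "contractive_on UNIV \<beta>" "\<And>x y. \<beta> (x \<otimes>\<^sub>i y) = \<alpha>\<^sub>1 x \<otimes>\<^sub>i \<alpha>\<^sub>2 y"
    using tensor_map_exists[OF a[THEN isometric_automorphism_imp_contractive]] by blast
  obtain \<gamma> where \<gamma>: "contractive_on UNIV \<gamma>"
    "\<And>x y. \<gamma> (x \<otimes>\<^sub>i y) = inv \<alpha>\<^sub>1 x \<otimes>\<^sub>i inv \<alpha>\<^sub>2 y"
    using tensor_map_exists[OF i1(1) i2(1)] by blast
  have comp: "contractive_on UNIV (\<lambda>u. f (g u))"
    if "contractive_on UNIV f" "contractive_on UNIV g"
    for f g :: "('a, 'b) injective_tensor \<Rightarrow> ('a, 'b) injective_tensor"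
    using that unfolding contractive_on_def clinear_on_def by (auto intro: order_trans)
  have ident: "contractive_on UNIV (\<lambda>u :: ('a, 'b) injective_tensor. u)"
    by (simp add: contractive_on_def clinear_on_def)
  have "(\<lambda>u. \<beta> (\<gamma> u)) = (\<lambda>u. u)" "(\<lambda>u. \<gamma> (\<beta> u)) = (\<lambda>u. u)"
    by (rule contractive_eq_on_tensors;
        simp add: comp ident \<beta> \<gamma> i1(2) i1(3) i2(2) i2(3))+
  then have inv: "\<beta> (\<gamma> u) = u" "\<gamma> (\<beta> u) = u" for u
    by metis+
  have "norm (\<beta> u) = norm u" for u
  proof (rule antisym)
    show "norm (\<beta> u) \<le> norm u"
      using \<beta>(1) by (simp add: contractive_on_def)
    have "norm (\<gamma> (\<beta> u)) \<le> norm (\<beta> u)"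
      using \<gamma>(1) by (simp add: contractive_on_def)
    then show "norm u \<le> norm (\<beta> u)"
      by (simp add: inv)
  qed
  moreover have "surj \<beta>"
    by (rule surjI) (rule inv(1))
  ultimately have iso: "isometric_automorphism \<beta>"
    using \<beta>(1) by (simp add: isometric_automorphism_def isometric_linear_def contractive_on_def)
  show ?thesis
  proof (rule ex1I[of _ \<beta>])
    show "isometric_automorphism \<beta> \<and> (\<forall>x y. \<beta> (x \<otimes>\<^sub>i y) = \<alpha>\<^sub>1 x \<otimes>\<^sub>i \<alpha>\<^sub>2 y)"
      using iso \<beta>(2) by blast
    fix \<beta>' assume "isometric_automorphism \<beta>' \<and> (\<forall>x y. \<beta>' (x \<otimes>\<^sub>i y) = \<alpha>\<^sub>1 x \<otimes>\<^sub>i \<alpha>\<^sub>2 y)"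
    then show "\<beta>' = \<beta>"
      by (intro contractive_eq_on_tensors) (auto simp: \<beta> isometric_automorphism_imp_contractive)
  qed
qed

lemmas tensor_automorphism =
  theI'[OF ex1_tensor_automorphism, folded tensor_automorphism_def]

end

theory Submission
  imports Defs
begin

text \<open>
  Tensoring CA triples \<open>(\<phi>\<^sub>1, \<psi>\<^sub>1, d\<^sub>1)\<close> and \<open>(\<phi>\<^sub>2, \<psi>\<^sub>2, d\<^sub>2)\<close> for the two factors should give a
  triple of dimension \<open>d\<^sub>1 d\<^sub>2\<close> for the tensor product, because
  \<open>\<ell>\<^sub>\<infinity>\<close> of dimension \<open>d\<^sub>1\<close> tensored injectively with \<open>\<ell>\<^sub>\<infinity>\<close> of dimension \<open>d\<^sub>2\<close> is
  \<open>\<ell>\<^sub>\<infinity>\<close> of dimension \<open>d\<^sub>1 d\<^sub>2\<close>. Logarithms turn the product into a sum, and subadditivity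
  of the limit superior then gives the inequality. The difficulty is that
  \<open>\<psi>\<^sub>1 \<otimes> \<psi>\<^sub>2\<close> maps into the tensor product of the targets of \<open>\<iota>\<^sub>1\<close> and \<open>\<iota>\<^sub>2\<close>, which has nothing
  to do with the target of the given \<open>\<iota>\<close>.

  This is resolved by a description of the admissible maps \<open>\<phi>\<close> that mentions no embedding.
  A contraction \<open>\<phi>\<close> into \<open>\<ell>\<^sub>\<infinity>\<close> of dimension \<open>d\<close> is the first component of a CA triple for
  \<open>\<Omega>\<close> exactly when, up to the tolerance, it shrinks linear combinations of the elements of
  \<open>\<Omega>\<close> by no more than a small multiple of the \<open>\<ell>\<^sub>1\<close> norm of the coefficients
  (\<open>CA_imp_almost_isometric\<close> and \<open>almost_isometric_imp_CA\<close>). One direction is the triangle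
  inequality. For the other, a Hahn--Banach argument (\<open>almost_isometric_extension\<close>) shows that
  every functional \<open>\<kappa>\<close> of norm at most one agrees up to \<open>\<epsilon>\<close> on \<open>\<Omega>\<close> with \<open>\<nu> \<circ> \<phi>\<close> for some
  functional \<open>\<nu>\<close> of norm at most one. Given any CA triple \<open>(\<phi>', \<psi>', d')\<close> of \<open>\<iota>\<close>, treating the
  coordinates of \<open>\<phi>'\<close> in this way yields a contraction \<open>\<Phi>\<close> with \<open>\<Phi> \<circ> \<phi>\<close> close to \<open>\<phi>'\<close>, and
  \<open>\<psi>' \<circ> \<Phi>\<close> completes \<open>\<phi>\<close> to a triple; the dimension \<open>d'\<close> disappears.

  It remains to see that \<open>\<phi>\<^sub>1 \<otimes> \<phi>\<^sub>2\<close> is almost isometric on elementary tensors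
  (\<open>almost_isometric_tensor\<close>). The injective norm is a supremum over pairs of functionals,
  and \<open>almost_isometric_extension\<close> replaces each of the two functionals by one that factors
  through \<open>\<phi>\<^sub>1\<close> or \<open>\<phi>\<^sub>2\<close>. An arbitrary finite set in the tensor product is finally approximated
  by sums of elementary tensors. As the automorphisms are isometric and act factorwise, the
  approximation, the number of summands and the norm bounds are the same along the whole orbit
  (\<open>rc_orbit_tensor\<close>), so one tolerance for the factors serves all \<open>n\<close>.
\<close>


section \<open>Linear functionals below sublinear ones\<close>

definition sublinear :: "('a::real_vector \<Rightarrow> real) \<Rightarrow> bool"
  where "sublinear p \<longleftrightarrow>
    (\<forall>x y. p (x + y) \<le> p x + p y) \<and> (\<forall>r x. 0 \<le> r \<longrightarrow> p (r *\<^sub>R x) = r * p x)"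

lemma sublinear_add: "sublinear p \<Longrightarrow> p (x + y) \<le> p x + p y"
  and sublinear_scaleR: "sublinear p \<Longrightarrow> 0 \<le> r \<Longrightarrow> p (r *\<^sub>R x) = r * p x"
  by (auto simp: sublinear_def)

lemma sublinear_0: "sublinear p \<Longrightarrow> p 0 = 0"
  using sublinear_scaleR[of p 0 0] by simp

lemma sublinear_minus: "sublinear p \<Longrightarrow> - p (- x) \<le> p x"
  using sublinear_add[of p x "- x"] sublinear_0[of p] by simp

text \<open>All infima below are of this kind: joint subadditivity and homogeneity in the argument and
  the parameter survive taking the infimum over the parameter. It is applied to chains of
  sublinear functionals, where of two parameters the smaller functional does, and to infimal
  convolutions, where parameters add.\<close>

lemma sublinear_INF:
  fixes F :: "'a::real_vector \<Rightarrow> 'k \<Rightarrow> real"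
  assumes zero: "k0 \<in> K" "F 0 k0 \<le> 0"
    and bdd: "\<And>x. bdd_below (F x ` K)"
    and add: "\<And>x y k l. k \<in> K \<Longrightarrow> l \<in> K \<Longrightarrow> \<exists>m\<in>K. F (x + y) m \<le> F x k + F y l"
    and scale: "\<And>r x k. 0 < r \<Longrightarrow> k \<in> K \<Longrightarrow> \<exists>m\<in>K. F (r *\<^sub>R x) m \<le> r * F x k"
  shows "sublinear (\<lambda>x. INF k\<in>K. F x k)"
proof -
  define p where "p = (\<lambda>x. INF k\<in>K. F x k)"
  have le: "p x \<le> F x k" if "k \<in> K" for x k
    unfolding p_def using bdd that by (rule cINF_lower)
  have ge: "b \<le> p x" if "\<And>k. k \<in> K \<Longrightarrow> b \<le> F x k" for b x
    unfolding p_def using zero(1) that by (intro cINF_greatest) auto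
  have sub: "p (x + y) \<le> p x + p y" for x y
  proof -
    have "p (x + y) - F x k \<le> p y" if k: "k \<in> K" for k
    proof (rule ge)
      fix l assume "l \<in> K"
      then obtain m where "m \<in> K" "F (x + y) m \<le> F x k + F y l"
        using add k by blast
      then show "p (x + y) - F x k \<le> F y l"
        using le[of m "x + y"] by linarith
    qed
    then have "p (x + y) - p y \<le> p x"
      by (intro ge) (simp add: algebra_simps)
    then show ?thesis by simp
  qed
  have half: "p (r *\<^sub>R x) \<le> r * p x" if r: "0 < r" for r x
  proof -
    have "p (r *\<^sub>R x) / r \<le> p x"
    proof (rule ge)
      fix k assume "k \<in> K"
      then obtain m where "m \<in> K" "F (r *\<^sub>R x) m \<le> r * F x k"
        using scale r by blast
      then show "p (r *\<^sub>R x) / r \<le> F x k"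
        using le[of m "r *\<^sub>R x"] r by (simp add: field_simps)
    qed
    then show ?thesis using r by (simp add: field_simps)
  qed
  have "p (r *\<^sub>R x) = r * p x" if "0 \<le> r" for r x
  proof (cases "r = 0")
    case True
    have "p 0 \<le> 0" using le[OF zero(1), of 0] zero(2) by simp
    moreover have "0 \<le> p 0" using sub[of 0 0] by simp
    ultimately show ?thesis using True by simp
  next
    case False
    with that have r: "0 < r" by simp
    have "p x \<le> inverse r * p (r *\<^sub>R x)"
      using half[of "inverse r" "r *\<^sub>R x"] r by simp
    then have "r * p x \<le> p (r *\<^sub>R x)"
      using r by (simp add: field_simps)
    with half[OF r, of x] show ?thesis by simp
  qed
  with sub show ?thesis
    unfolding p_def[symmetric] sublinear_def by blast
qed

text \<open>This is the Hahn--Banach theorem. A sublinear functional \<open>p\<close> that is minimal for the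
  pointwise order is linear, because \<open>x \<mapsto> inf\<^sub>t p (x + t y) - t p y\<close> over \<open>t \<ge> 0\<close> is
  again sublinear and lies below \<open>p\<close>; minimality and the value at \<open>x = - y\<close>, \<open>t = 1\<close>
  give \<open>p (- y) \<le> - p y\<close>.\<close>

theorem sublinear_dominates_linear:
  fixes q :: "'a::real_vector \<Rightarrow> real"
  assumes q: "sublinear q"
  obtains \<mu> where "linear \<mu>" "\<And>x. \<mu> x \<le> q x"
proof -
  define S where "S = {p :: 'a \<Rightarrow> real. sublinear p \<and> p \<le> q}"
  define P where "P = (\<lambda>p p' :: 'a \<Rightarrow> real. p' \<le> p)"
  have po: "partial_order_on S (relation_of P S)"
    unfolding P_def
    by (auto simp: partial_order_on_def preorder_on_def refl_on_def trans_def antisym_def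
        relation_of_def)
  have ch: "\<exists>u\<in>S. \<forall>p\<in>C. P p u" if C: "C \<in> Chains (relation_of P S)" for C
  proof (cases "C = {}")
    case True
    then show ?thesis using q by (intro bexI[of _ q]) (auto simp: S_def)
  next
    case False
    then obtain p0 where p0: "p0 \<in> C" by blast
    have CS: "sublinear p" "p \<le> q" if "p \<in> C" for p
      using C that by (auto simp: Chains_def relation_of_def S_def)
    have total: "p \<le> p' \<or> p' \<le> p" if "p \<in> C" "p' \<in> C" for p p'
      using C that by (auto simp: Chains_def relation_of_def P_def)
    define u where "u = (\<lambda>x. INF p\<in>C. p x)"
    have bdd: "bdd_below ((\<lambda>p. p x) ` C)" for x
    proof (rule bdd_belowI2)
      fix p assume "p \<in> C"
      then show "- q (- x) \<le> p x"
        using CS[of p] sublinear_minus[of p x] by (meson le_funD neg_le_iff_le order_trans)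
    qed
    have "sublinear u"
      unfolding u_def
    proof (rule sublinear_INF[OF p0 _ bdd])
      show "p0 0 \<le> 0" using CS(1)[OF p0] by (simp add: sublinear_0)
      show "\<exists>m\<in>C. m (x + y) \<le> p x + p' y" if "p \<in> C" "p' \<in> C" for x y p p'
        using total[OF that]
      proof
        assume "p \<le> p'"
        then have "p (x + y) \<le> p x + p' y"
          using sublinear_add[OF CS(1)[OF that(1)], of x y] le_funD[of p p' y] by linarith
        then show ?thesis using that by blast
      next
        assume "p' \<le> p"
        then have "p' (x + y) \<le> p x + p' y"
          using sublinear_add[OF CS(1)[OF that(2)], of x y] le_funD[of p' p x] by linarith
        then show ?thesis using that by blast
      qed
      show "\<exists>m\<in>C. m (r *\<^sub>R x) \<le> r * p x" if "0 < r" "p \<in> C" for r x p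
        using that CS(1) by (intro bexI[of _ p]) (auto simp: sublinear_scaleR)
    qed
    moreover have low: "u \<le> p" if "p \<in> C" for p
      unfolding u_def using bdd that by (auto intro!: le_funI cINF_lower)
    moreover have "u \<le> q"
      using low[OF p0] CS(2)[OF p0] by (rule order_trans)
    ultimately show ?thesis
      by (intro bexI[of _ u]) (auto simp: S_def P_def)
  qed
  from predicate_Zorn[OF po ch] obtain p where p: "p \<in> S" and
    min: "\<And>p'. p' \<in> S \<Longrightarrow> p' \<le> p \<Longrightarrow> p' = p"
    unfolding P_def by blast
  have sp: "sublinear p" and pq: "p \<le> q" using p by (auto simp: S_def)
  have odd: "p (- y) = - p y" for y
  proof -
    define F where "F = (\<lambda>x t. p (x + t *\<^sub>R y) - t * p y)"
    define p' where "p' = (\<lambda>x. INF t\<in>{0..}. F x t)"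
    have bdd: "bdd_below (F x ` {0..})" for x
    proof (rule bdd_belowI2)
      fix t :: real assume "t \<in> {0..}"
      then have "t * p y = p ((x + t *\<^sub>R y) + (- x))"
        using sublinear_scaleR[OF sp, of t y] by simp
      also have "\<dots> \<le> p (x + t *\<^sub>R y) + p (- x)" by (rule sublinear_add[OF sp])
      finally show "- p (- x) \<le> F x t" by (simp add: F_def)
    qed
    have low: "p' x \<le> F x t" if "0 \<le> t" for x t
      unfolding p'_def using bdd that by (intro cINF_lower) auto
    have "sublinear p'"
      unfolding p'_def
    proof (rule sublinear_INF[OF _ _ bdd, of 0])
      show "F 0 0 \<le> 0" by (simp add: F_def sublinear_0[OF sp])
      show "\<exists>m\<in>{0..}. F (x + x') m \<le> F x s + F x' t" if "s \<in> {0..}" "t \<in> {0..}" for x x' s t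
        using sublinear_add[OF sp, of "x + s *\<^sub>R y" "x' + t *\<^sub>R y"] that
        by (intro bexI[of _ "s + t"]) (auto simp: F_def algebra_simps)
      show "\<exists>m\<in>{0..}. F (r *\<^sub>R x) m \<le> r * F x t" if "0 < r" "t \<in> {0..}" for r x t
        using sublinear_scaleR[OF sp, of r "x + t *\<^sub>R y"] that
        by (intro bexI[of _ "r * t"]) (auto simp: F_def algebra_simps)
    qed simp
    moreover have "p' \<le> p"
      using low[of 0] by (intro le_funI) (simp add: F_def)
    ultimately have "p' = p"
      using pq by (intro min) (auto simp: S_def)
    then have "p (- y) \<le> - p y"
      using low[of 1 "- y"] by (simp add: F_def sublinear_0[OF sp])
    with sublinear_minus[OF sp, of y] show ?thesis by linarith
  qed
  have "linear p"
  proof (rule linearI)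
    show "p (x + y) = p x + p y" for x y
      using sublinear_add[OF sp, of x y] sublinear_add[OF sp, of "- x" "- y"] odd[of "x + y"]
      by (simp add: odd)
    show "p (r *\<^sub>R x) = r *\<^sub>R p x" for r x
    proof (cases "0 \<le> r")
      case True
      then show ?thesis by (simp add: sublinear_scaleR[OF sp])
    next
      case False
      then show ?thesis
        using sublinear_scaleR[OF sp, of "- r" x] odd[of "r *\<^sub>R x"] by simp
    qed
  qed
  with pq show thesis by (intro that[of p]) (auto dest: le_funD)
qed


section \<open>Almost isometric maps and approximate extension\<close>

lemma scaleC_zero_left [simp]: "0 *\<^sub>C (x::'a::complex_normed_vector) = 0"
  using scaleC_of_real[of 0 x] by simp

lemma scaleC_minus_one: "(- 1) *\<^sub>C (x::'a::complex_normed_vector) = - x"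
  using scaleC_of_real[of "- 1" x] by simp

lemma scaleC_diff_right: "c *\<^sub>C (x - y) = c *\<^sub>C x - c *\<^sub>C (y::'a::complex_normed_vector)"
  using scaleC_add_right[of c "x - y" y] by simp

lemma clinear_add: "clinear f \<Longrightarrow> f (x + y) = f x + f y"
  and clinear_scaleC: "clinear f \<Longrightarrow> f (c *\<^sub>C x) = c *\<^sub>C f x"
  by (auto simp: clinear_on_def)

lemma clinear_zero: "clinear f \<Longrightarrow> f 0 = 0"
  using clinear_scaleC[of f 0 0] by simp

lemma clinear_minus: "clinear f \<Longrightarrow> f (- x) = - f x"
  using clinear_scaleC[of f "- 1" x] by (simp add: scaleC_minus_one)

lemma clinear_diff: "clinear f \<Longrightarrow> f (x - y) = f x - f y"
  using clinear_add[of f x "- y"] clinear_minus[of f y] by simp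

lemma clinear_sum: "clinear f \<Longrightarrow> f (\<Sum>i\<in>I. g i) = (\<Sum>i\<in>I. f (g i))"
  by (induction I rule: infinite_finite_induct) (auto simp: clinear_zero clinear_add)

lemma clinear_combination:
  "clinear f \<Longrightarrow> f (\<Sum>i\<in>I. c i *\<^sub>C x i) = (\<Sum>i\<in>I. c i *\<^sub>C f (x i))"
  by (simp add: clinear_sum clinear_scaleC)

lemma contractive_clinear: "contractive_on UNIV f \<Longrightarrow> clinear f"
  and contractive_norm: "contractive_on UNIV f \<Longrightarrow> norm (f x) \<le> norm x"
  by (auto simp: contractive_on_def)

text \<open>Multiplying the argument by a phase reduces estimates on the modulus to estimates on the
  real part.\<close>

lemma ex_phase: "\<exists>t::complex. cmod t = 1 \<and> t * z = complex_of_real (cmod z)"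
proof (cases "z = 0")
  case True
  then show ?thesis by (intro exI[of _ 1]) simp
next
  case False
  moreover have "z * cnj z = complex_of_real (cmod z) * complex_of_real (cmod z)"
    using complex_norm_square[of z] by (simp add: power2_eq_square)
  ultimately show ?thesis
    by (intro exI[of _ "cnj z / cmod z"]) (simp add: norm_divide field_simps)
qed

lemma real_functional_complexify:
  fixes \<mu> :: "'a::complex_normed_vector \<Rightarrow> real"
  assumes lin: "linear \<mu>" and le: "\<And>x. \<mu> x \<le> norm x"
  obtains \<nu> :: "'a \<Rightarrow> complex" where "contractive_on UNIV \<nu>" "\<And>x. Re (\<nu> x) = \<mu> x"
proof -
  define \<nu> where "\<nu> = (\<lambda>x. Complex (\<mu> x) (- \<mu> (\<i> *\<^sub>C x)))"
  have scaleR: "\<mu> (complex_of_real r *\<^sub>C x) = r * \<mu> x" for r x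
    using linear_cmul[OF lin, of r x] by (simp add: scaleC_of_real)
  have split: "\<mu> (c *\<^sub>C x) = Re c * \<mu> x + Im c * \<mu> (\<i> *\<^sub>C x)" for c x
  proof -
    have "c *\<^sub>C x = complex_of_real (Re c) *\<^sub>C x + complex_of_real (Im c) *\<^sub>C (\<i> *\<^sub>C x)"
      by (subst (1) complex_eq[of c])
        (simp add: scaleC_add_left scaleC_scaleC mult.commute)
    then show ?thesis by (simp add: linear_add[OF lin] scaleR)
  qed
  have "clinear \<nu>"
    unfolding clinear_on_def
  proof (intro conjI ballI allI)
    show "\<nu> (x + y) = \<nu> x + \<nu> y" for x y
      by (simp add: \<nu>_def linear_add[OF lin] scaleC_add_right complex_eq_iff)
    show "\<nu> (c *\<^sub>C x) = c *\<^sub>C \<nu> x" for c x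
      using split[of c x] split[of "\<i> * c" x]
      by (simp add: \<nu>_def scaleC_scaleC scaleC_complex_def complex_eq_iff)
  qed
  moreover have "cmod (\<nu> x) \<le> norm x" for x
  proof -
    obtain t where t: "cmod t = 1" "t * \<nu> x = complex_of_real (cmod (\<nu> x))"
      using ex_phase by blast
    have "cmod (\<nu> x) = Re (\<nu> (t *\<^sub>C x))"
      using clinear_scaleC[OF \<open>clinear \<nu>\<close>, of t x] t(2) by (simp add: scaleC_complex_def)
    also have "\<dots> \<le> norm (t *\<^sub>C x)" using le by (simp add: \<nu>_def)
    finally show ?thesis by (simp add: norm_scaleC t(1))
  qed
  ultimately show thesis
    by (intro that[of \<nu>]) (auto simp: contractive_on_def \<nu>_def)
qed

text \<open>The defect is measured by the \<open>\<ell>\<^sub>1\<close> norm of the coefficients because this norm is dual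
  to a uniform error over the vectors of the family: it is what the triangle inequality produces
  from such an error, and the Hahn--Banach theorem turns it back into one.\<close>

definition almost_isometric_on ::
  "('a::complex_normed_vector \<Rightarrow> 'b::complex_normed_vector) \<Rightarrow> 'i set \<Rightarrow> ('i \<Rightarrow> 'a) \<Rightarrow> real \<Rightarrow> bool"
  where "almost_isometric_on \<phi> I x \<epsilon> \<longleftrightarrow>
    (\<forall>c. norm (\<Sum>i\<in>I. c i *\<^sub>C x i) \<le> norm (\<phi> (\<Sum>i\<in>I. c i *\<^sub>C x i)) + \<epsilon> * (\<Sum>i\<in>I. cmod (c i)))"

text \<open>Approximate extension of \<open>\<kappa>\<close> along \<open>\<phi>\<close>. With \<open>v c\<close> the combination of the family with
  coefficients \<open>c\<close> and \<open>\<bar>c\<bar>\<^sub>1\<close> the \<open>\<ell>\<^sub>1\<close> norm of \<open>c\<close>, let \<open>q w\<close> be the infimum over \<open>c\<close> of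
  \<open>\<parallel>w + \<phi> (v c)\<parallel> + \<epsilon> \<bar>c\<bar>\<^sub>1 - Re (\<kappa> (v c))\<close>. Almost isometry bounds it below by \<open>- \<parallel>w\<parallel>\<close>, so
  \<open>q\<close> is sublinear. A linear functional below \<open>q\<close> has norm at most one, as \<open>c = 0\<close> shows, and
  \<open>w = - \<phi> (v c)\<close> with \<open>c\<close> a phase concentrated at one index gives the estimate there.\<close>

lemma almost_isometric_extension:
  fixes \<phi> :: "'a::complex_normed_vector \<Rightarrow> 'b::complex_normed_vector" and \<kappa> :: "'a \<Rightarrow> complex"
  assumes I: "finite I" and \<epsilon>: "0 \<le> \<epsilon>" and \<phi>: "clinear \<phi>" and iso: "almost_isometric_on \<phi> I x \<epsilon>"
    and \<kappa>: "contractive_on UNIV \<kappa>"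
  obtains \<nu> :: "'b \<Rightarrow> complex" where "contractive_on UNIV \<nu>"
    "\<And>i. i \<in> I \<Longrightarrow> cmod (\<nu> (\<phi> (x i)) - \<kappa> (x i)) \<le> \<epsilon>"
proof -
  note cl = contractive_clinear[OF \<kappa>]
  define v where "v = (\<lambda>c. \<Sum>i\<in>I. c i *\<^sub>C x i)"
  define F where "F = (\<lambda>w c. norm (w + \<phi> (v c)) + \<epsilon> * (\<Sum>i\<in>I. cmod (c i)) - Re (\<kappa> (v c)))"
  define q where "q = (\<lambda>w. INF c. F w c)"
  have v_add: "v (\<lambda>i. c i + d i) = v c + v d" for c d
    by (simp add: v_def scaleC_add_left sum.distrib)
  have v_scale: "v (\<lambda>i. complex_of_real r * c i) = r *\<^sub>R v c" for r c
    by (simp add: v_def scaleR_sum_right scaleC_of_real flip: scaleC_scaleC)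
  have \<phi>R: "\<phi> (r *\<^sub>R z) = r *\<^sub>R \<phi> z" and \<kappa>R: "\<kappa> (r *\<^sub>R z) = r *\<^sub>R \<kappa> z" for r z
    using clinear_scaleC[OF \<phi>, of "complex_of_real r" z]
      clinear_scaleC[OF cl, of "complex_of_real r" z] by (simp_all add: scaleC_of_real)
  have bdd: "bdd_below (range (F w))" for w
  proof (rule bdd_belowI2)
    fix c :: "_ \<Rightarrow> complex"
    have "Re (\<kappa> (v c)) \<le> norm (v c)"
      using contractive_norm[OF \<kappa>, of "v c"] complex_Re_le_cmod order_trans by blast
    also have "\<dots> \<le> norm (\<phi> (v c)) + \<epsilon> * (\<Sum>i\<in>I. cmod (c i))"
      using iso by (simp add: almost_isometric_on_def v_def)
    also have "norm (\<phi> (v c)) \<le> norm (w + \<phi> (v c)) + norm w"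
      using norm_triangle_ineq4[of "w + \<phi> (v c)" w] by simp
    finally show "- norm w \<le> F w c" by (simp add: F_def)
  qed
  have low: "q w \<le> F w c" for w c
    unfolding q_def using bdd by (intro cINF_lower) auto
  have "sublinear q"
    unfolding q_def
  proof (rule sublinear_INF[OF _ _ bdd, of "\<lambda>_. 0"])
    show "F 0 (\<lambda>_. 0) \<le> 0"
      by (simp add: F_def v_def clinear_zero[OF \<phi>] clinear_zero[OF cl])
    show "\<exists>m\<in>UNIV. F (w + z) m \<le> F w c + F z d" for w z and c d :: "_ \<Rightarrow> complex"
    proof (intro bexI)
      have "norm (w + z + \<phi> (v c + v d)) \<le> norm (w + \<phi> (v c)) + norm (z + \<phi> (v d))"
        using norm_triangle_ineq[of "w + \<phi> (v c)" "z + \<phi> (v d)"]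
        by (simp add: clinear_add[OF \<phi>] algebra_simps)
      moreover have "(\<Sum>i\<in>I. cmod (c i + d i)) \<le> (\<Sum>i\<in>I. cmod (c i)) + (\<Sum>i\<in>I. cmod (d i))"
        by (simp add: sum_mono norm_triangle_ineq flip: sum.distrib)
      then have "\<epsilon> * (\<Sum>i\<in>I. cmod (c i + d i)) \<le> \<epsilon> * (\<Sum>i\<in>I. cmod (c i)) + \<epsilon> * (\<Sum>i\<in>I. cmod (d i))"
        using \<epsilon> by (metis mult_left_mono distrib_left)
      ultimately show "F (w + z) (\<lambda>i. c i + d i) \<le> F w c + F z d"
        by (simp add: F_def v_add clinear_add[OF cl])
    qed simp
    show "\<exists>m\<in>UNIV. F (r *\<^sub>R w) m \<le> r * F w c" if "0 < r" for r w and c :: "_ \<Rightarrow> complex"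
    proof (intro bexI)
      have "norm (r *\<^sub>R w + \<phi> (r *\<^sub>R v c)) = r * norm (w + \<phi> (v c))"
        using that by (simp add: \<phi>R flip: scaleR_add_right)
      then show "F (r *\<^sub>R w) (\<lambda>i. complex_of_real r * c i) \<le> r * F w c"
        using that by (simp add: F_def v_scale \<kappa>R norm_mult algebra_simps flip: sum_distrib_left)
    qed simp
  qed simp
  then obtain \<mu> where \<mu>: "linear \<mu>" "\<And>w. \<mu> w \<le> q w"
    using sublinear_dominates_linear by blast
  have "\<mu> w \<le> norm w" for w
    using order_trans[OF \<mu>(2) low[of w "\<lambda>_. 0"]]
    by (simp add: F_def v_def clinear_zero[OF \<phi>] clinear_zero[OF cl])
  with \<mu>(1) obtain \<nu> where \<nu>: "contractive_on UNIV \<nu>" "\<And>w. Re (\<nu> w) = \<mu> w"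
    using real_functional_complexify by blast
  note cn = contractive_clinear[OF \<nu>(1)]
  have "cmod (\<nu> (\<phi> (x i)) - \<kappa> (x i)) \<le> \<epsilon>" if i: "i \<in> I" for i
  proof -
    define z where "z = \<kappa> (x i) - \<nu> (\<phi> (x i))"
    obtain t where t: "cmod t = 1" "t * z = complex_of_real (cmod z)"
      using ex_phase by blast
    define c where "c = (\<lambda>j. if j = i then t else 0)"
    have "v c = (\<Sum>j\<in>I. if j = i then t *\<^sub>C x i else 0)"
      unfolding v_def c_def by (rule sum.cong) auto
    then have vc: "v c = t *\<^sub>C x i" using I i by simp
    have "(\<Sum>j\<in>I. cmod (c j)) = (\<Sum>j\<in>I. if j = i then 1 else 0)"
      unfolding c_def using t(1) by (intro sum.cong) auto
    then have sc: "(\<Sum>j\<in>I. cmod (c j)) = 1" using I i by simp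
    have "\<mu> (- \<phi> (v c)) \<le> F (- \<phi> (v c)) c"
      using \<mu>(2) low order_trans by blast
    then have "- Re (\<nu> (\<phi> (v c))) \<le> \<epsilon> - Re (\<kappa> (v c))"
      by (simp add: F_def sc flip: \<nu>(2)) (simp add: clinear_minus[OF cn])
    then have "Re (t * z) \<le> \<epsilon>"
      by (simp add: vc z_def clinear_scaleC[OF \<phi>] clinear_scaleC[OF cl] clinear_scaleC[OF cn]
          scaleC_complex_def algebra_simps)
    then have "cmod z \<le> \<epsilon>" using t(2) by simp
    then show ?thesis by (simp add: z_def norm_minus_commute)
  qed
  with \<nu>(1) show thesis by (rule that)
qed


section \<open>CA triples from almost isometric maps\<close>

lemma contractive_on_compose:
  assumes \<phi>: "contractive_on UNIV \<phi>" "range \<phi> \<subseteq> S" and \<psi>: "contractive_on S \<psi>"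
  shows "contractive_on UNIV (\<lambda>x. \<psi> (\<phi> x))"
proof -
  have S: "\<phi> x \<in> S" for x using \<phi>(2) by blast
  have "norm (\<psi> (\<phi> x)) \<le> norm x" for x
    using \<psi> S[of x] contractive_norm[OF \<phi>(1), of x] order_trans
    unfolding contractive_on_def by blast
  then show ?thesis
    using \<phi>(1) \<psi> S by (auto simp: contractive_on_def clinear_on_def)
qed

lemma CA_D:
  assumes "(\<phi>, \<psi>, d) \<in> CA \<iota> \<Omega> \<epsilon>"
  shows "0 < d" "range \<phi> \<subseteq> ell_inf d" "contractive_on UNIV \<phi>" "contractive_on (ell_inf d) \<psi>"
    "contractive_on UNIV (\<lambda>x. \<psi> (\<phi> x))" "\<And>x. x \<in> \<Omega> \<Longrightarrow> norm (\<psi> (\<phi> x) - \<iota> x) < \<epsilon>"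
  using assms by (auto simp: CA_def intro: contractive_on_compose)

lemma clinear_difference:
  "clinear f \<Longrightarrow> clinear g \<Longrightarrow> clinear (\<lambda>x. f x - g x)"
  by (simp add: clinear_on_def scaleC_diff_right)

lemma CA_imp_almost_isometric:
  assumes \<iota>: "isometric_linear \<iota>" and CA: "(\<phi>, \<psi>, d) \<in> CA \<iota> (x ` I) \<epsilon>"
  shows "almost_isometric_on \<phi> I x \<epsilon>"
  unfolding almost_isometric_on_def
proof
  fix c :: "_ \<Rightarrow> complex"
  define v where "v = (\<Sum>i\<in>I. c i *\<^sub>C x i)"
  have inl: "clinear \<iota>" and inorm: "norm (\<iota> v) = norm v"
    using \<iota> by (auto simp: isometric_linear_def)
  note ca = CA_D[OF CA]
  have lin: "clinear (\<lambda>x. \<iota> x - \<psi> (\<phi> x))"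
    by (intro clinear_difference inl contractive_clinear[OF ca(5)])
  have "norm (\<iota> v - \<psi> (\<phi> v)) = norm (\<Sum>i\<in>I. c i *\<^sub>C (\<iota> (x i) - \<psi> (\<phi> (x i))))"
    unfolding v_def using clinear_combination[OF lin, of c x I] by simp
  also have "\<dots> \<le> (\<Sum>i\<in>I. cmod (c i) * \<epsilon>)"
    using ca(6) by (intro sum_norm_le)
      (auto simp: norm_scaleC norm_minus_commute less_imp_le intro!: mult_left_mono)
  finally have "norm (\<iota> v - \<psi> (\<phi> v)) \<le> \<epsilon> * (\<Sum>i\<in>I. cmod (c i))"
    by (simp add: sum_distrib_left mult.commute)
  moreover have "norm (\<psi> (\<phi> v)) \<le> norm (\<phi> v)"
    using ca(2,4) by (auto simp: contractive_on_def)
  ultimately show "norm v \<le> norm (\<phi> v) + \<epsilon> * (\<Sum>i\<in>I. cmod (c i))"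
    using norm_triangle_ineq[of "\<iota> v - \<psi> (\<phi> v)" "\<psi> (\<phi> v)"] inorm by simp
qed

lemma contractive_into_ell_inf:
  fixes \<nu> :: "nat \<Rightarrow> 'a::complex_normed_vector \<Rightarrow> complex"
  assumes \<nu>: "\<And>k. k < d \<Longrightarrow> contractive_on UNIV (\<nu> k)"
  obtains \<Phi> where "contractive_on UNIV \<Phi>" "range \<Phi> \<subseteq> ell_inf d"
    "\<And>x k. apply_bcontfun (\<Phi> x) k = (if k < d then \<nu> k x else 0)"
proof -
  define \<Phi> where "\<Phi> = (\<lambda>x. Bcontfun (\<lambda>k. if k < d then \<nu> k x else 0))"
  have app: "apply_bcontfun (\<Phi> x) k = (if k < d then \<nu> k x else 0)" for x k
  proof -
    have "(\<lambda>k. if k < d then \<nu> k x else 0) \<in> bcontfun"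
      by (rule bcontfun_normI[of _ "norm x"]) (auto simp: contractive_norm[OF \<nu>])
    then show ?thesis by (simp add: \<Phi>_def Bcontfun_inverse)
  qed
  have "contractive_on UNIV \<Phi>"
    unfolding contractive_on_def clinear_on_def
  proof (intro conjI ballI allI)
    show "\<Phi> (x + y) = \<Phi> x + \<Phi> y" for x y
      by (rule bcontfun_eqI) (simp add: app clinear_add[OF contractive_clinear[OF \<nu>]])
    show "\<Phi> (c *\<^sub>C x) = c *\<^sub>C \<Phi> x" for c x
      by (rule bcontfun_eqI) (simp add: app clinear_scaleC[OF contractive_clinear[OF \<nu>]])
    show "norm (\<Phi> x) \<le> norm x" for x
      by (rule norm_bound) (simp add: app contractive_norm[OF \<nu>])
  qed
  moreover have "range \<Phi> \<subseteq> ell_inf d" by (auto simp: ell_inf_def app)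
  ultimately show thesis using app by (rule that)
qed

lemma contractive_coordinate:
  assumes "contractive_on UNIV \<phi>"
  shows "contractive_on UNIV (\<lambda>x. apply_bcontfun (\<phi> x) k)"
proof -
  have "norm (apply_bcontfun (\<phi> x) k) \<le> norm x" for x
    using norm_bounded contractive_norm[OF assms, of x] order_trans by blast
  then show ?thesis
    using assms by (simp add: contractive_on_def clinear_on_def)
qed

text \<open>Only the closeness of some CA triple of \<open>\<iota>\<close> to \<open>\<iota>\<close> enters; its dimension is arbitrary.
  This is why the least dimension does not depend on the embedding.\<close>

lemma almost_isometric_imp_CA:
  fixes x :: "'i \<Rightarrow> 'a::complex_banach" and \<iota> :: "'a \<Rightarrow> 'e::complex_banach"
  assumes \<iota>: "CA_embedding \<iota>" and I: "finite I" and \<epsilon>: "0 \<le> \<epsilon>" "\<epsilon> < \<delta>"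
    and \<phi>: "contractive_on UNIV \<phi>" "range \<phi> \<subseteq> ell_inf d" "0 < d"
    and iso: "almost_isometric_on \<phi> I x \<epsilon>"
  shows "\<exists>\<psi>. (\<phi>, \<psi>, d) \<in> CA \<iota> (x ` I) \<delta>"
proof -
  have "finite (x ` I)" "\<delta> - \<epsilon> > 0" using I \<epsilon> by auto
  then have "CA \<iota> (x ` I) (\<delta> - \<epsilon>) \<noteq> {}"
    using \<iota> unfolding CA_embedding_def by blast
  then obtain \<phi>' \<psi>' d' where CA: "(\<phi>', \<psi>', d') \<in> CA \<iota> (x ` I) (\<delta> - \<epsilon>)"
    by (metis ex_in_conv prod_cases3)
  note ca = CA_D[OF CA]
  have "\<exists>\<nu> :: (nat \<Rightarrow>\<^sub>C complex) \<Rightarrow> complex. contractive_on UNIV \<nu> \<and>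
      (\<forall>i\<in>I. cmod (\<nu> (\<phi> (x i)) - apply_bcontfun (\<phi>' (x i)) k) \<le> \<epsilon>)" for k
    using almost_isometric_extension[OF I \<epsilon>(1) contractive_clinear[OF \<phi>(1)] iso
        contractive_coordinate[OF ca(3)], of k] by metis
  then obtain \<nu> :: "nat \<Rightarrow> (nat \<Rightarrow>\<^sub>C complex) \<Rightarrow> complex" where
    \<nu>: "\<And>k. contractive_on UNIV (\<nu> k)"
      "\<And>k i. i \<in> I \<Longrightarrow> cmod (\<nu> k (\<phi> (x i)) - apply_bcontfun (\<phi>' (x i)) k) \<le> \<epsilon>"
    by metis
  obtain \<Phi> where \<Phi>: "contractive_on UNIV \<Phi>" "range \<Phi> \<subseteq> ell_inf d'"
    "\<And>w k. apply_bcontfun (\<Phi> w) k = (if k < d' then \<nu> k w else 0)"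
    using contractive_into_ell_inf[of d' \<nu>] \<nu>(1) by blast
  have \<psi>: "contractive_on UNIV (\<lambda>w. \<psi>' (\<Phi> w))"
    using \<Phi>(1,2) ca(4) by (rule contractive_on_compose)
  have "norm (\<psi>' (\<Phi> (\<phi> (x i))) - \<iota> (x i)) < \<delta>" if i: "i \<in> I" for i
  proof -
    have mem: "\<Phi> w \<in> ell_inf d'" "\<phi>' z \<in> ell_inf d'" for w z
      using \<Phi>(2) ca(2) by blast+
    let ?a = "\<Phi> (\<phi> (x i))" and ?b = "\<phi>' (x i)"
    have "norm (?a - ?b) \<le> \<epsilon>"
    proof (rule norm_bound)
      show "cmod (apply_bcontfun (?a - ?b) k) \<le> \<epsilon>" for k
        using \<nu>(2)[OF i, of k] mem(2)[of "x i"] \<epsilon>(1) by (simp add: \<Phi>(3) ell_inf_def)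
    qed
    moreover have "norm (\<psi>' ?a - \<psi>' ?b) \<le> norm (?a - ?b)"
    proof -
      have ab: "?a - ?b \<in> ell_inf d'" using mem by (auto simp: ell_inf_def)
      have "\<psi>' ((?a - ?b) + ?b) = \<psi>' (?a - ?b) + \<psi>' ?b"
        using ca(4) ab mem unfolding contractive_on_def clinear_on_def by blast
      then have "\<psi>' ?a - \<psi>' ?b = \<psi>' (?a - ?b)" by simp
      then show ?thesis using ca(4) ab by (simp add: contractive_on_def)
    qed
    moreover have "norm (\<psi>' ?b - \<iota> (x i)) < \<delta> - \<epsilon>" using ca(6) i by blast
    ultimately show ?thesis
      using norm_triangle_ineq[of "\<psi>' ?a - \<psi>' ?b" "\<psi>' ?b - \<iota> (x i)"] by simp
  qed
  then have "(\<phi>, \<lambda>w. \<psi>' (\<Phi> w), d) \<in> CA \<iota> (x ` I) \<delta>"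
    using \<phi> \<psi> by (auto simp: CA_def contractive_on_def clinear_on_def)
  then show ?thesis by blast
qed


section \<open>Tensoring two CA triples\<close>

lemma contractive_tensor_evaluation: "contractive_on UNIV (\<lambda>u. apply_bcontfun (tensor_fun u) p)"
  by (auto simp: contractive_on_def clinear_on_def plus_injective_tensor.rep_eq
      scaleC_injective_tensor.rep_eq norm_injective_tensor.rep_eq norm_bounded)

lemma dual_apply_Dual: "contractive_on UNIV \<kappa> \<Longrightarrow> dual_apply (Dual \<kappa>) = \<kappa>"
  by (simp add: Dual_inverse)

lemma tensor_fun_combination:
  "apply_bcontfun (tensor_fun (\<Sum>i\<in>I. c i *\<^sub>C (x i \<otimes>\<^sub>i y i))) (f, g) =
    (\<Sum>i\<in>I. c i * dual_apply f (x i) * dual_apply g (y i))"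
  by (subst clinear_combination[OF contractive_clinear[OF contractive_tensor_evaluation]])
    (simp add: tensor.rep_eq scaleC_complex_def mult.assoc)

text \<open>The map \<open>\<phi>\<^sub>1 \<otimes> \<phi>\<^sub>2\<close>. The coordinates of \<open>\<phi>\<^sub>1\<close> and \<open>\<phi>\<^sub>2\<close> are points of the dual balls, and
  an element of the tensor product is a function on pairs of such points, so it suffices to
  evaluate there; pairs \<open>(i, j)\<close> are numbered row by row.\<close>

lemma tensor_of_contractions:
  fixes \<phi>\<^sub>1 :: "'a::complex_banach \<Rightarrow> (nat \<Rightarrow>\<^sub>C complex)" and \<phi>\<^sub>2 :: "'b::complex_banach \<Rightarrow> (nat \<Rightarrow>\<^sub>C complex)"
  assumes "contractive_on UNIV \<phi>\<^sub>1" "contractive_on UNIV \<phi>\<^sub>2"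
  obtains \<Phi> where "contractive_on UNIV \<Phi>" "range \<Phi> \<subseteq> ell_inf (d\<^sub>1 * d\<^sub>2)"
    "\<And>u i j. i < d\<^sub>1 \<Longrightarrow> j < d\<^sub>2 \<Longrightarrow> apply_bcontfun (\<Phi> u) (i * d\<^sub>2 + j) =
      apply_bcontfun (tensor_fun u)
        (Dual (\<lambda>x. apply_bcontfun (\<phi>\<^sub>1 x) i), Dual (\<lambda>y. apply_bcontfun (\<phi>\<^sub>2 y) j))"
proof -
  define \<nu> where "\<nu> = (\<lambda>k u. apply_bcontfun (tensor_fun u)
    (Dual (\<lambda>x. apply_bcontfun (\<phi>\<^sub>1 x) (k div d\<^sub>2)), Dual (\<lambda>y. apply_bcontfun (\<phi>\<^sub>2 y) (k mod d\<^sub>2))))"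
  have "contractive_on UNIV (\<nu> k)" for k
    unfolding \<nu>_def by (rule contractive_tensor_evaluation)
  then obtain \<Phi> where \<Phi>: "contractive_on UNIV \<Phi>" "range \<Phi> \<subseteq> ell_inf (d\<^sub>1 * d\<^sub>2)"
    "\<And>u k. apply_bcontfun (\<Phi> u) k = (if k < d\<^sub>1 * d\<^sub>2 then \<nu> k u else 0)"
    using contractive_into_ell_inf[of "d\<^sub>1 * d\<^sub>2" \<nu>] by blast
  have "i * d\<^sub>2 + j < d\<^sub>1 * d\<^sub>2" if "i < d\<^sub>1" "j < d\<^sub>2" for i j
  proof -
    have "i * d\<^sub>2 + j < Suc i * d\<^sub>2" using that by simp
    also have "\<dots> \<le> d\<^sub>1 * d\<^sub>2" using that by (intro mult_le_mono1) simp
    finally show ?thesis .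
  qed
  with \<Phi> show thesis
    by (intro that[of \<Phi>]) (auto simp: \<nu>_def)
qed

lemma norm_contractive_functional_le_coordinates:
  fixes \<nu> :: "(nat \<Rightarrow>\<^sub>C complex) \<Rightarrow> complex"
  assumes \<nu>: "contractive_on UNIV \<nu>" and w: "w \<in> ell_inf d" and b: "0 \<le> b"
    and le: "\<And>k. k < d \<Longrightarrow> cmod (apply_bcontfun w k) \<le> b"
  shows "cmod (\<nu> w) \<le> b"
proof -
  have "norm w \<le> b"
    using w le b by (intro norm_bound) (metis (mono_tags) ell_inf_def mem_Collect_eq norm_zero not_le)
  with contractive_norm[OF \<nu>, of w] show ?thesis by linarith
qed

lemma ell_inf_combination:
  "range \<phi> \<subseteq> ell_inf d \<Longrightarrow> (\<Sum>i\<in>I. c i *\<^sub>C \<phi> (x i)) \<in> ell_inf d"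
  by (induction I rule: infinite_finite_induct) (auto simp: ell_inf_def scaleC_complex_def image_subset_iff)

lemma apply_combination:
  "apply_bcontfun (\<Sum>i\<in>I. c i *\<^sub>C w i) k = (\<Sum>i\<in>I. c i * apply_bcontfun (w i) k)"
  for w :: "'i \<Rightarrow> (nat \<Rightarrow>\<^sub>C complex)"
  by (induction I rule: infinite_finite_induct) (auto simp: scaleC_complex_def)

text \<open>The functional \<open>\<nu>\<^sub>1 \<otimes> \<nu>\<^sub>2\<close> on matrices has norm at most one for the maximum norm of the
  entries: \<open>\<nu>\<^sub>1\<close> acts on the columns first, and \<open>\<nu>\<^sub>2\<close> on the resulting row.\<close>

lemma tensor_functional_bound:
  fixes x :: "'i \<Rightarrow> 'a::complex_banach" and y :: "'i \<Rightarrow> 'b::complex_banach"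
  assumes \<phi>\<^sub>1: "contractive_on UNIV \<phi>\<^sub>1" "range \<phi>\<^sub>1 \<subseteq> ell_inf d\<^sub>1"
    and \<phi>\<^sub>2: "contractive_on UNIV \<phi>\<^sub>2" "range \<phi>\<^sub>2 \<subseteq> ell_inf d\<^sub>2"
    and \<nu>: "contractive_on UNIV \<nu>\<^sub>1" "contractive_on UNIV \<nu>\<^sub>2"
    and \<Phi>: "\<And>u i j. i < d\<^sub>1 \<Longrightarrow> j < d\<^sub>2 \<Longrightarrow> apply_bcontfun (\<Phi> u) (i * d\<^sub>2 + j) =
      apply_bcontfun (tensor_fun u)
        (Dual (\<lambda>x. apply_bcontfun (\<phi>\<^sub>1 x) i), Dual (\<lambda>y. apply_bcontfun (\<phi>\<^sub>2 y) j))"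
  shows "cmod (\<Sum>i\<in>I. c i * \<nu>\<^sub>1 (\<phi>\<^sub>1 (x i)) * \<nu>\<^sub>2 (\<phi>\<^sub>2 (y i)))
    \<le> norm (\<Phi> (\<Sum>i\<in>I. c i *\<^sub>C (x i \<otimes>\<^sub>i y i)) :: nat \<Rightarrow>\<^sub>C complex)"
proof -
  define v where "v = (\<Sum>i\<in>I. c i *\<^sub>C (x i \<otimes>\<^sub>i y i))"
  have entry: "cmod (\<Sum>i\<in>I. c i * apply_bcontfun (\<phi>\<^sub>1 (x i)) k * apply_bcontfun (\<phi>\<^sub>2 (y i)) l)
    \<le> norm (\<Phi> v)" if "k < d\<^sub>1" "l < d\<^sub>2" for k l
    using norm_bounded[of "\<Phi> v" "k * d\<^sub>2 + l"] \<Phi>[OF that, of v]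
    by (simp add: v_def tensor_fun_combination dual_apply_Dual contractive_coordinate \<phi>\<^sub>1 \<phi>\<^sub>2)
  have row: "cmod (\<Sum>i\<in>I. (c i * \<nu>\<^sub>1 (\<phi>\<^sub>1 (x i))) * apply_bcontfun (\<phi>\<^sub>2 (y i)) l) \<le> norm (\<Phi> v)"
    if l: "l < d\<^sub>2" for l
  proof -
    have "cmod (\<nu>\<^sub>1 (\<Sum>i\<in>I. (c i * apply_bcontfun (\<phi>\<^sub>2 (y i)) l) *\<^sub>C \<phi>\<^sub>1 (x i))) \<le> norm (\<Phi> v)"
      using entry[OF _ l]
      by (intro norm_contractive_functional_le_coordinates[OF \<nu>(1) ell_inf_combination[OF \<phi>\<^sub>1(2)]])
        (auto simp: apply_combination mult_ac)
    then show ?thesis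
      by (simp add: clinear_combination[OF contractive_clinear[OF \<nu>(1)]] scaleC_complex_def mult_ac)
  qed
  have "cmod (\<nu>\<^sub>2 (\<Sum>i\<in>I. (c i * \<nu>\<^sub>1 (\<phi>\<^sub>1 (x i))) *\<^sub>C \<phi>\<^sub>2 (y i))) \<le> norm (\<Phi> v)"
    using row
    by (intro norm_contractive_functional_le_coordinates[OF \<nu>(2) ell_inf_combination[OF \<phi>\<^sub>2(2)]])
      (auto simp: apply_combination)
  then show ?thesis
    by (simp add: clinear_combination[OF contractive_clinear[OF \<nu>(2)]] scaleC_complex_def v_def)
qed

text \<open>Replacing \<open>f x * g y\<close> by \<open>\<nu>\<^sub>1 (\<phi>\<^sub>1 x) * \<nu>\<^sub>2 (\<phi>\<^sub>2 y)\<close> changes one factor at a time, at a cost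
  of at most \<open>M * \<epsilon>\<close> each; hence the constant \<open>2 * M * \<epsilon>\<close>.\<close>

lemma almost_isometric_tensor:
  fixes \<phi>\<^sub>1 :: "'a::complex_banach \<Rightarrow> (nat \<Rightarrow>\<^sub>C complex)" and \<phi>\<^sub>2 :: "'b::complex_banach \<Rightarrow> (nat \<Rightarrow>\<^sub>C complex)"
  assumes \<phi>\<^sub>1: "contractive_on UNIV \<phi>\<^sub>1" "range \<phi>\<^sub>1 \<subseteq> ell_inf d\<^sub>1"
    and \<phi>\<^sub>2: "contractive_on UNIV \<phi>\<^sub>2" "range \<phi>\<^sub>2 \<subseteq> ell_inf d\<^sub>2"
    and fin: "finite \<Omega>\<^sub>1" "finite \<Omega>\<^sub>2" and \<epsilon>: "0 \<le> \<epsilon>"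
    and iso: "almost_isometric_on \<phi>\<^sub>1 \<Omega>\<^sub>1 (\<lambda>x. x) \<epsilon>" "almost_isometric_on \<phi>\<^sub>2 \<Omega>\<^sub>2 (\<lambda>y. y) \<epsilon>"
    and M: "\<And>x. x \<in> \<Omega>\<^sub>1 \<Longrightarrow> norm x \<le> M" "\<And>y. y \<in> \<Omega>\<^sub>2 \<Longrightarrow> norm y \<le> M"
  obtains \<Phi> where "contractive_on UNIV \<Phi>" "range \<Phi> \<subseteq> ell_inf (d\<^sub>1 * d\<^sub>2)"
    "almost_isometric_on \<Phi> (\<Omega>\<^sub>1 \<times> \<Omega>\<^sub>2) (\<lambda>(x, y). x \<otimes>\<^sub>i y) (2 * M * \<epsilon>)"
proof -
  obtain \<Phi> where \<Phi>: "contractive_on UNIV \<Phi>" "range \<Phi> \<subseteq> ell_inf (d\<^sub>1 * d\<^sub>2)"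
    "\<And>u i j. i < d\<^sub>1 \<Longrightarrow> j < d\<^sub>2 \<Longrightarrow> apply_bcontfun (\<Phi> u) (i * d\<^sub>2 + j) =
      apply_bcontfun (tensor_fun u)
        (Dual (\<lambda>x. apply_bcontfun (\<phi>\<^sub>1 x) i), Dual (\<lambda>y. apply_bcontfun (\<phi>\<^sub>2 y) j))"
    using tensor_of_contractions[OF \<phi>\<^sub>1(1) \<phi>\<^sub>2(1)] by blast
  let ?I = "\<Omega>\<^sub>1 \<times> \<Omega>\<^sub>2"
  have "almost_isometric_on \<Phi> ?I (\<lambda>p. fst p \<otimes>\<^sub>i snd p) (2 * M * \<epsilon>)"
    unfolding almost_isometric_on_def
  proof
    fix c :: "'a \<times> 'b \<Rightarrow> complex"
    define v where "v = (\<Sum>p\<in>?I. c p *\<^sub>C (fst p \<otimes>\<^sub>i snd p))"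
    have "cmod (apply_bcontfun (tensor_fun v) (f, g))
      \<le> norm (\<Phi> v) + 2 * M * \<epsilon> * (\<Sum>p\<in>?I. cmod (c p))" for f g
    proof -
      obtain \<nu>\<^sub>1 where \<nu>\<^sub>1: "contractive_on UNIV \<nu>\<^sub>1"
        "\<And>x. x \<in> \<Omega>\<^sub>1 \<Longrightarrow> cmod (\<nu>\<^sub>1 (\<phi>\<^sub>1 x) - dual_apply f x) \<le> \<epsilon>"
        using almost_isometric_extension[OF fin(1) \<epsilon> contractive_clinear[OF \<phi>\<^sub>1(1)] iso(1)
            dual_apply_contractive[of f]] by metis
      obtain \<nu>\<^sub>2 where \<nu>\<^sub>2: "contractive_on UNIV \<nu>\<^sub>2"
        "\<And>y. y \<in> \<Omega>\<^sub>2 \<Longrightarrow> cmod (\<nu>\<^sub>2 (\<phi>\<^sub>2 y) - dual_apply g y) \<le> \<epsilon>"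
        using almost_isometric_extension[OF fin(2) \<epsilon> contractive_clinear[OF \<phi>\<^sub>2(1)] iso(2)
            dual_apply_contractive[of g]] by metis
      define A where "A = (\<lambda>p. dual_apply f (fst p) * dual_apply g (snd p))"
      define B where "B = (\<lambda>p. \<nu>\<^sub>1 (\<phi>\<^sub>1 (fst p)) * \<nu>\<^sub>2 (\<phi>\<^sub>2 (snd p)))"
      have AB: "cmod (A p - B p) \<le> 2 * M * \<epsilon>" if p: "p \<in> ?I" for p
      proof -
        obtain x y where xy: "p = (x, y)" "x \<in> \<Omega>\<^sub>1" "y \<in> \<Omega>\<^sub>2" using p by auto
        have "cmod (dual_apply g y) \<le> M"
          using norm_dual_apply_le[of g y] M(2)[OF xy(3)] by linarith
        moreover have "cmod (\<nu>\<^sub>1 (\<phi>\<^sub>1 x)) \<le> M"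
          using contractive_norm[OF \<nu>\<^sub>1(1), of "\<phi>\<^sub>1 x"] contractive_norm[OF \<phi>\<^sub>1(1), of x] M(1)[OF xy(2)]
          by linarith
        moreover have "A p - B p = (dual_apply f x - \<nu>\<^sub>1 (\<phi>\<^sub>1 x)) * dual_apply g y
          + \<nu>\<^sub>1 (\<phi>\<^sub>1 x) * (dual_apply g y - \<nu>\<^sub>2 (\<phi>\<^sub>2 y))"
          by (simp add: A_def B_def xy(1) algebra_simps)
        moreover have "cmod (dual_apply f x - \<nu>\<^sub>1 (\<phi>\<^sub>1 x)) \<le> \<epsilon>" "cmod (dual_apply g y - \<nu>\<^sub>2 (\<phi>\<^sub>2 y)) \<le> \<epsilon>"
          using \<nu>\<^sub>1(2)[OF xy(2)] \<nu>\<^sub>2(2)[OF xy(3)] by (simp_all add: norm_minus_commute)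
        moreover have "0 \<le> M"
          using M(1)[OF xy(2)] norm_ge_zero order_trans by blast
        ultimately have "cmod (A p - B p) \<le> \<epsilon> * M + M * \<epsilon>"
          using \<epsilon> by (simp only: norm_mult norm_ge_zero norm_triangle_mono mult_mono)
        then show ?thesis by (simp add: algebra_simps)
      qed
      have "apply_bcontfun (tensor_fun v) (f, g) = (\<Sum>p\<in>?I. c p * A p)"
        unfolding v_def tensor_fun_combination A_def by (simp add: mult.assoc)
      also have "\<dots> = (\<Sum>p\<in>?I. c p * B p) + (\<Sum>p\<in>?I. c p * (A p - B p))"
        by (simp add: algebra_simps flip: sum.distrib)
      finally have "cmod (apply_bcontfun (tensor_fun v) (f, g)) \<le>
        cmod (\<Sum>p\<in>?I. c p * B p) + cmod (\<Sum>p\<in>?I. c p * (A p - B p))"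
        by (simp add: norm_triangle_ineq)
      moreover have "cmod (\<Sum>p\<in>?I. c p * B p) \<le> norm (\<Phi> v)"
        using tensor_functional_bound[OF \<phi>\<^sub>1 \<phi>\<^sub>2 \<nu>\<^sub>1(1) \<nu>\<^sub>2(1) \<Phi>(3), of c fst snd ?I]
        unfolding v_def B_def by (simp add: mult.assoc)
      moreover have "cmod (\<Sum>p\<in>?I. c p * (A p - B p)) \<le> (\<Sum>p\<in>?I. cmod (c p) * (2 * M * \<epsilon>))"
        using AB by (intro sum_norm_le) (auto simp: norm_mult intro!: mult_left_mono)
      ultimately show ?thesis by (simp add: sum_distrib_left mult.commute)
    qed
    then show "norm v \<le> norm (\<Phi> v) + 2 * M * \<epsilon> * (\<Sum>p\<in>?I. cmod (c p))"
      unfolding norm_injective_tensor.rep_eq by (intro norm_bound) auto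
  qed
  then have "almost_isometric_on \<Phi> ?I (\<lambda>(x, y). x \<otimes>\<^sub>i y) (2 * M * \<epsilon>)"
    by (simp add: case_prod_unfold)
  with \<Phi>(1,2) show thesis by (rule that)
qed

lemma CA_tensor:
  assumes \<iota>: "CA_embedding \<iota>" "isometric_linear \<iota>\<^sub>1" "isometric_linear \<iota>\<^sub>2"
    and CA: "(\<phi>\<^sub>1, \<psi>\<^sub>1, d\<^sub>1) \<in> CA \<iota>\<^sub>1 \<Omega>\<^sub>1 \<epsilon>" "(\<phi>\<^sub>2, \<psi>\<^sub>2, d\<^sub>2) \<in> CA \<iota>\<^sub>2 \<Omega>\<^sub>2 \<epsilon>"
    and fin: "finite \<Omega>\<^sub>1" "finite \<Omega>\<^sub>2"
    and M: "0 \<le> M" "\<And>x. x \<in> \<Omega>\<^sub>1 \<Longrightarrow> norm x \<le> M" "\<And>y. y \<in> \<Omega>\<^sub>2 \<Longrightarrow> norm y \<le> M"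
    and \<epsilon>: "0 \<le> \<epsilon>" "2 * M * \<epsilon> < \<delta>"
  shows "\<exists>\<phi> \<psi>. (\<phi>, \<psi>, d\<^sub>1 * d\<^sub>2) \<in> CA \<iota> ((\<lambda>(x, y). x \<otimes>\<^sub>i y) ` (\<Omega>\<^sub>1 \<times> \<Omega>\<^sub>2)) \<delta>"
proof -
  note ca1 = CA_D[OF CA(1)] and ca2 = CA_D[OF CA(2)]
  have "almost_isometric_on \<phi>\<^sub>1 \<Omega>\<^sub>1 (\<lambda>x. x) \<epsilon>" "almost_isometric_on \<phi>\<^sub>2 \<Omega>\<^sub>2 (\<lambda>y. y) \<epsilon>"
    using CA by (auto intro!: CA_imp_almost_isometric \<iota>)
  then obtain \<Phi> where \<Phi>: "contractive_on UNIV \<Phi>" "range \<Phi> \<subseteq> ell_inf (d\<^sub>1 * d\<^sub>2)"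
    "almost_isometric_on \<Phi> (\<Omega>\<^sub>1 \<times> \<Omega>\<^sub>2) (\<lambda>(x, y). x \<otimes>\<^sub>i y) (2 * M * \<epsilon>)"
    using almost_isometric_tensor[OF ca1(3,2) ca2(3,2) fin \<epsilon>(1) _ _ M(2,3)] by blast
  have "0 \<le> 2 * M * \<epsilon>" "0 < d\<^sub>1 * d\<^sub>2" "finite (\<Omega>\<^sub>1 \<times> \<Omega>\<^sub>2)"
    using M(1) \<epsilon>(1) ca1(1) ca2(1) fin by auto
  then show ?thesis
    using almost_isometric_imp_CA[OF \<iota>(1) _ _ \<epsilon>(2) \<Phi>(1,2) _ \<Phi>(3)] by blast
qed


section \<open>Dimension bounds and the entropy inequality\<close>

lemma rc_attained:
  assumes "CA_embedding \<iota>" "finite \<Omega>" "0 < \<epsilon>"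
  obtains \<phi> \<psi> where "(\<phi>, \<psi>, rc \<iota> \<Omega> \<epsilon>) \<in> CA \<iota> \<Omega> \<epsilon>"
proof -
  have "CA \<iota> \<Omega> \<epsilon> \<noteq> {}" using assms unfolding CA_embedding_def by blast
  then have "{d. \<exists>\<phi> \<psi>. (\<phi>, \<psi>, d) \<in> CA \<iota> \<Omega> \<epsilon>} \<noteq> {}"
    by (metis (mono_tags, lifting) empty_iff ex_in_conv mem_Collect_eq prod_cases3)
  from Inf_nat_def1[OF this] show thesis
    using that unfolding rc_def by blast
qed

lemma rc_pos: "CA_embedding \<iota> \<Longrightarrow> finite \<Omega> \<Longrightarrow> 0 < \<epsilon> \<Longrightarrow> 0 < rc \<iota> \<Omega> \<epsilon>"
  using rc_attained CA_D(1) by metis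

lemma rc_le: "(\<phi>, \<psi>, d) \<in> CA \<iota> \<Omega> \<epsilon> \<Longrightarrow> rc \<iota> \<Omega> \<epsilon> \<le> d"
  unfolding rc_def by (rule cInf_lower) auto

lemma clinear_sum_list: "clinear f \<Longrightarrow> f (sum_list us) = sum_list (map f us)"
  by (induction us) (auto simp: clinear_zero clinear_add)

lemma norm_sum_list_le:
  "(\<And>u. u \<in> set us \<Longrightarrow> norm (u::'a::real_normed_vector) \<le> b) \<Longrightarrow> norm (sum_list us) \<le> real (length us) * b"
proof (induction us)
  case (Cons u us)
  then have "norm u + norm (sum_list us) \<le> b + real (length us) * b"
    by (intro add_mono) auto
  then show ?case
    using norm_triangle_ineq[of u "sum_list us"] by (simp add: algebra_simps)
qed simp

text \<open>The error \<open>\<psi> \<circ> \<phi> - \<iota>\<close> is linear of norm at most two. So it passes from \<open>T\<close> to sums of at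
  most \<open>L\<close> of its elements at the cost of the factor \<open>L\<close>, and to their neighbours within
  \<open>\<rho>\<close> at the additional cost \<open>2 * \<rho>\<close>.\<close>

lemma CA_extend_to_sums:
  assumes \<iota>: "isometric_linear \<iota>" and CA: "(\<phi>, \<psi>, d) \<in> CA \<iota> T \<eta>"
    and \<eta>: "0 \<le> \<eta>" "2 * \<rho> + real L * \<eta> \<le> \<delta>"
    and near: "\<And>u. u \<in> \<Omega> \<Longrightarrow> \<exists>us. set us \<subseteq> T \<and> length us \<le> L \<and> norm (u - sum_list us) < \<rho>"
  shows "(\<phi>, \<psi>, d) \<in> CA \<iota> \<Omega> \<delta>"
proof -
  note ca = CA_D[OF CA]
  define E where "E = (\<lambda>u. \<psi> (\<phi> u) - \<iota> u)"
  have inl: "clinear \<iota>" and inorm: "norm (\<iota> v) = norm v" for v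
    using \<iota> by (auto simp: isometric_linear_def)
  have E: "clinear E"
    unfolding E_def by (intro clinear_difference inl contractive_clinear[OF ca(5)])
  have E2: "norm (E u) \<le> 2 * norm u" for u
    using norm_triangle_ineq4[of "\<psi> (\<phi> u)" "\<iota> u"] contractive_norm[OF ca(5), of u] inorm[of u]
    by (simp add: E_def)
  have "norm (E u) < \<delta>" if u: "u \<in> \<Omega>" for u
  proof -
    obtain us where us: "set us \<subseteq> T" "length us \<le> L" "norm (u - sum_list us) < \<rho>"
      using near[OF u] by blast
    have "norm (E (sum_list us)) \<le> real (length (map E us)) * \<eta>"
      unfolding clinear_sum_list[OF E]
      by (rule norm_sum_list_le) (use us(1) ca(6) in \<open>auto simp: E_def intro: less_imp_le\<close>)
    also have "\<dots> \<le> real L * \<eta>" using us(2) \<eta>(1) by (intro mult_right_mono) auto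
    finally have "norm (E (sum_list us)) \<le> real L * \<eta>" .
    moreover have "norm (E u) \<le> norm (E (u - sum_list us)) + norm (E (sum_list us))"
      using norm_triangle_ineq[of "E (u - sum_list us)" "E (sum_list us)"]
      by (simp add: clinear_diff[OF E])
    ultimately show ?thesis using E2[of "u - sum_list us"] us(3) \<eta>(2) by linarith
  qed
  then show ?thesis using ca by (simp add: CA_def E_def)
qed

lemma isometric_automorphism_funpow:
  assumes "isometric_automorphism \<alpha>"
  shows "clinear (\<alpha> ^^ k)" "norm ((\<alpha> ^^ k) x) = norm x"
proof -
  have "clinear (\<alpha> ^^ k) \<and> (\<forall>x. norm ((\<alpha> ^^ k) x) = norm x)"
    using assms
    by (induction k) (auto simp: isometric_automorphism_def isometric_linear_def clinear_on_def)
  then show "clinear (\<alpha> ^^ k)" "norm ((\<alpha> ^^ k) x) = norm x" by auto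
qed

lemma tensor_automorphism_funpow:
  assumes "isometric_automorphism \<alpha>\<^sub>1" "isometric_automorphism \<alpha>\<^sub>2"
  shows "(tensor_automorphism \<alpha>\<^sub>1 \<alpha>\<^sub>2 ^^ k) (x \<otimes>\<^sub>i y) = (\<alpha>\<^sub>1 ^^ k) x \<otimes>\<^sub>i (\<alpha>\<^sub>2 ^^ k) y"
  using tensor_automorphism[OF assms] by (induction k) auto

text \<open>The finite sets consist of the left and right factors in sums of elementary tensors that
  approximate the elements of \<open>\<Omega>\<close>. The tolerance depends only on the number of summands and on
  the norms of the factors, neither of which changes along the orbit, so it serves for all
  \<open>n\<close> at once.\<close>

lemma rc_orbit_tensor:
  fixes \<iota> :: "('a::complex_banach, 'b::complex_banach) injective_tensor \<Rightarrow> 'e::complex_banach"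
  assumes \<alpha>: "isometric_automorphism \<alpha>\<^sub>1" "isometric_automorphism \<alpha>\<^sub>2"
    and emb: "CA_embedding \<iota>\<^sub>1" "CA_embedding \<iota>\<^sub>2" "CA_embedding \<iota>"
    and \<Omega>: "finite \<Omega>" and \<delta>: "0 < \<delta>"
  obtains \<Omega>\<^sub>1 \<Omega>\<^sub>2 \<epsilon> where "finite \<Omega>\<^sub>1" "finite \<Omega>\<^sub>2" "0 < \<epsilon>"
    "\<And>n. rc \<iota> (\<Union>k<n. (tensor_automorphism \<alpha>\<^sub>1 \<alpha>\<^sub>2 ^^ k) ` \<Omega>) \<delta> \<le>
      rc \<iota>\<^sub>1 (\<Union>k<n. (\<alpha>\<^sub>1 ^^ k) ` \<Omega>\<^sub>1) \<epsilon> * rc \<iota>\<^sub>2 (\<Union>k<n. (\<alpha>\<^sub>2 ^^ k) ` \<Omega>\<^sub>2) \<epsilon>"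
proof -
  let ?\<beta> = "tensor_automorphism \<alpha>\<^sub>1 \<alpha>\<^sub>2"
  let ?t = "\<lambda>(x :: 'a, y :: 'b). x \<otimes>\<^sub>i y"
  have \<beta>: "isometric_automorphism ?\<beta>" using tensor_automorphism[OF \<alpha>] by blast
  have isom: "isometric_linear \<iota>\<^sub>1" "isometric_linear \<iota>\<^sub>2" "isometric_linear \<iota>"
    using emb by (auto simp: CA_embedding_def)
  have "\<exists>ps. norm (u - sum_list (map ?t ps)) < \<delta> / 4" for u :: "('a, 'b) injective_tensor"
  proof -
    have "u \<in> closure (range (\<lambda>ps. \<Sum>(x, y)\<leftarrow>ps. x \<otimes>\<^sub>i y))" by (simp add: tensor_dense)
    then show ?thesis
      unfolding closure_approachable using \<delta>
      by (metis (no_types, lifting) dist_commute dist_norm divide_pos_pos rangeE zero_less_numeral)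
  qed
  then obtain ps where ps: "\<And>u :: ('a, 'b) injective_tensor. norm (u - sum_list (map ?t (ps u))) < \<delta> / 4"
    by metis
  \<comment> \<open>The sums only provide convenient common bounds for the lengths and for the norms.\<close>
  define L where "L = (\<Sum>u\<in>\<Omega>. length (ps u))"
  define \<Omega>\<^sub>1 where "\<Omega>\<^sub>1 = (\<Union>u\<in>\<Omega>. fst ` set (ps u))"
  define \<Omega>\<^sub>2 where "\<Omega>\<^sub>2 = (\<Union>u\<in>\<Omega>. snd ` set (ps u))"
  have fin: "finite \<Omega>\<^sub>1" "finite \<Omega>\<^sub>2" using \<Omega> by (auto simp: \<Omega>\<^sub>1_def \<Omega>\<^sub>2_def)
  define M where "M = (\<Sum>x\<in>\<Omega>\<^sub>1. norm x) + (\<Sum>y\<in>\<Omega>\<^sub>2. norm y)"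
  have M0: "0 \<le> M" by (simp add: M_def sum_nonneg)
  have M: "norm x \<le> M" if "x \<in> \<Omega>\<^sub>1" for x
    using member_le_sum[OF that _ fin(1), of norm] sum_nonneg[of \<Omega>\<^sub>2 norm] by (simp add: M_def)
  have M': "norm y \<le> M" if "y \<in> \<Omega>\<^sub>2" for y
    using member_le_sum[OF that _ fin(2), of norm] sum_nonneg[of \<Omega>\<^sub>1 norm] by (simp add: M_def)
  \<comment> \<open>\<open>\<eta>\<close> is the tolerance on elementary tensors; half of \<open>\<delta>\<close> is left for the sums of at
    most \<open>L\<close> of them, the other half pays for the approximation within \<open>\<delta> / 4\<close>. Adding 1 in
    the denominators covers \<open>L = 0\<close> and \<open>M = 0\<close>.\<close>
  define \<eta> where "\<eta> = \<delta> / (2 * (real L + 1))"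
  have \<eta>: "0 < \<eta>" "2 * (\<delta> / 4) + real L * \<eta> \<le> \<delta>"
    using \<delta> by (auto simp: \<eta>_def field_simps)
  define \<epsilon> where "\<epsilon> = \<eta> / (2 * M + 1)"
  have \<epsilon>: "0 < \<epsilon>" "2 * M * \<epsilon> < \<eta>"
    using \<eta>(1) M0 by (auto simp: \<epsilon>_def field_simps)
  have "rc \<iota> (\<Union>k<n. (?\<beta> ^^ k) ` \<Omega>) \<delta> \<le>
      rc \<iota>\<^sub>1 (\<Union>k<n. (\<alpha>\<^sub>1 ^^ k) ` \<Omega>\<^sub>1) \<epsilon> * rc \<iota>\<^sub>2 (\<Union>k<n. (\<alpha>\<^sub>2 ^^ k) ` \<Omega>\<^sub>2) \<epsilon>" for n
  proof -
    define O\<^sub>1 where "O\<^sub>1 = (\<Union>k<n. (\<alpha>\<^sub>1 ^^ k) ` \<Omega>\<^sub>1)"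
    define O\<^sub>2 where "O\<^sub>2 = (\<Union>k<n. (\<alpha>\<^sub>2 ^^ k) ` \<Omega>\<^sub>2)"
    have finO: "finite O\<^sub>1" "finite O\<^sub>2" using fin by (auto simp: O\<^sub>1_def O\<^sub>2_def)
    have MO: "\<And>x. x \<in> O\<^sub>1 \<Longrightarrow> norm x \<le> M" "\<And>y. y \<in> O\<^sub>2 \<Longrightarrow> norm y \<le> M"
      using M M' by (auto simp: O\<^sub>1_def O\<^sub>2_def isometric_automorphism_funpow(2)[OF \<alpha>(1)]
          isometric_automorphism_funpow(2)[OF \<alpha>(2)])
    obtain \<phi>\<^sub>1 \<psi>\<^sub>1 where ca1: "(\<phi>\<^sub>1, \<psi>\<^sub>1, rc \<iota>\<^sub>1 O\<^sub>1 \<epsilon>) \<in> CA \<iota>\<^sub>1 O\<^sub>1 \<epsilon>"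
      using rc_attained[OF emb(1) finO(1) \<epsilon>(1)] by blast
    obtain \<phi>\<^sub>2 \<psi>\<^sub>2 where ca2: "(\<phi>\<^sub>2, \<psi>\<^sub>2, rc \<iota>\<^sub>2 O\<^sub>2 \<epsilon>) \<in> CA \<iota>\<^sub>2 O\<^sub>2 \<epsilon>"
      using rc_attained[OF emb(2) finO(2) \<epsilon>(1)] by blast
    obtain \<phi> \<psi> where ca: "(\<phi>, \<psi>, rc \<iota>\<^sub>1 O\<^sub>1 \<epsilon> * rc \<iota>\<^sub>2 O\<^sub>2 \<epsilon>) \<in> CA \<iota> (?t ` (O\<^sub>1 \<times> O\<^sub>2)) \<eta>"
      using CA_tensor[OF emb(3) isom(1,2) ca1 ca2 finO M0 MO less_imp_le[OF \<epsilon>(1)] \<epsilon>(2)] by blast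
    have "(\<phi>, \<psi>, rc \<iota>\<^sub>1 O\<^sub>1 \<epsilon> * rc \<iota>\<^sub>2 O\<^sub>2 \<epsilon>) \<in> CA \<iota> (\<Union>k<n. (?\<beta> ^^ k) ` \<Omega>) \<delta>"
    proof (rule CA_extend_to_sums[OF isom(3) ca _ \<eta>(2)])
      fix w assume "w \<in> (\<Union>k<n. (?\<beta> ^^ k) ` \<Omega>)"
      then obtain k u where k: "k < n" "u \<in> \<Omega>" "w = (?\<beta> ^^ k) u" by blast
      note lin = isometric_automorphism_funpow(1)[OF \<beta>, of k]
      define us where "us = map (\<lambda>p. (?\<beta> ^^ k) (?t p)) (ps u)"
      have "sum_list us = (?\<beta> ^^ k) (sum_list (map ?t (ps u)))"
        by (simp add: us_def clinear_sum_list[OF lin] o_def)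
      then have "norm (w - sum_list us) < \<delta> / 4"
        using ps[of u] isometric_automorphism_funpow(2)[OF \<beta>, of k "u - sum_list (map ?t (ps u))"]
        by (simp add: k(3) clinear_diff[OF lin])
      moreover have "set us \<subseteq> ?t ` (O\<^sub>1 \<times> O\<^sub>2)"
      proof
        fix z assume "z \<in> set us"
        then obtain x y where xy: "(x, y) \<in> set (ps u)" "z = (\<alpha>\<^sub>1 ^^ k) x \<otimes>\<^sub>i (\<alpha>\<^sub>2 ^^ k) y"
          by (auto simp: us_def tensor_automorphism_funpow[OF \<alpha>])
        have "x \<in> \<Omega>\<^sub>1" "y \<in> \<Omega>\<^sub>2" using xy(1) k(2) by (force simp: \<Omega>\<^sub>1_def \<Omega>\<^sub>2_def)+
        then have "((\<alpha>\<^sub>1 ^^ k) x, (\<alpha>\<^sub>2 ^^ k) y) \<in> O\<^sub>1 \<times> O\<^sub>2"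
          using k(1) by (auto simp: O\<^sub>1_def O\<^sub>2_def)
        then show "z \<in> ?t ` (O\<^sub>1 \<times> O\<^sub>2)" using xy(2) by (metis (mono_tags, lifting) case_prod_conv image_eqI)
      qed
      moreover have "length us \<le> L"
        unfolding us_def L_def using member_le_sum[OF k(2) _ \<Omega>, of "\<lambda>u. length (ps u)"] by simp
      ultimately show "\<exists>us. set us \<subseteq> ?t ` (O\<^sub>1 \<times> O\<^sub>2) \<and> length us \<le> L \<and> norm (w - sum_list us) < \<delta> / 4"
        by blast
    qed (use \<eta> in simp)
    then show ?thesis unfolding O\<^sub>1_def O\<^sub>2_def by (rule rc_le)
  qed
  with fin \<epsilon>(1) show thesis by (rule that)
qed

lemma hc_set_tol_le_hc:
  assumes "finite \<Omega>" "0 < \<epsilon>"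
  shows "hc_set_tol \<iota> \<alpha> \<Omega> \<epsilon> \<le> hc \<iota> \<alpha>"
proof -
  have "hc_set_tol \<iota> \<alpha> \<Omega> \<epsilon> \<le> hc_set \<iota> \<alpha> \<Omega>"
    unfolding hc_set_def using assms by (intro SUP_upper) auto
  also have "\<dots> \<le> hc \<iota> \<alpha>"
    unfolding hc_def using assms by (intro SUP_upper) auto
  finally show ?thesis .
qed

lemma ln_of_nat_le_add:
  assumes "a \<le> b * c" "0 < b" "0 < c"
  shows "ln (real a) \<le> ln (real b) + ln (real c)"
proof (cases "a = 0")
  case False
  have "real a \<le> real b * real c" using assms(1) by (simp flip: of_nat_mult)
  then have "ln (real a) \<le> ln (real b * real c)" using False by simp
  then show ?thesis using assms by (simp add: ln_mult)
next
  case True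
  then show ?thesis using assms by simp
qed

theorem proposition7p1:
  fixes \<alpha>\<^sub>1 :: "'a::complex_banach \<Rightarrow> 'a"
    and \<alpha>\<^sub>2 :: "'b::complex_banach \<Rightarrow> 'b"
    and \<iota>\<^sub>1 :: "'a \<Rightarrow> 'c::complex_banach"
    and \<iota>\<^sub>2 :: "'b \<Rightarrow> 'd::complex_banach"
    and \<iota> :: "('a, 'b) injective_tensor \<Rightarrow> 'e::complex_banach"
  assumes "isometric_automorphism \<alpha>\<^sub>1" and "isometric_automorphism \<alpha>\<^sub>2"
    and "CA_embedding \<iota>\<^sub>1" and "CA_embedding \<iota>\<^sub>2" and "CA_embedding \<iota>"
  shows "hc \<iota> (tensor_automorphism \<alpha>\<^sub>1 \<alpha>\<^sub>2) \<le> hc \<iota>\<^sub>1 \<alpha>\<^sub>1 + hc \<iota>\<^sub>2 \<alpha>\<^sub>2"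
proof -
  let ?\<beta> = "tensor_automorphism \<alpha>\<^sub>1 \<alpha>\<^sub>2"
  have "hc_set_tol \<iota> ?\<beta> \<Omega> \<delta> \<le> hc \<iota>\<^sub>1 \<alpha>\<^sub>1 + hc \<iota>\<^sub>2 \<alpha>\<^sub>2" if \<Omega>\<delta>: "finite \<Omega>" "0 < \<delta>" for \<Omega> \<delta>
  proof -
    obtain \<Omega>\<^sub>1 \<Omega>\<^sub>2 \<epsilon> where fin: "finite \<Omega>\<^sub>1" "finite \<Omega>\<^sub>2" and \<epsilon>: "0 < \<epsilon>" and
      le: "\<And>n. rc \<iota> (\<Union>k<n. (?\<beta> ^^ k) ` \<Omega>) \<delta> \<le>
        rc \<iota>\<^sub>1 (\<Union>k<n. (\<alpha>\<^sub>1 ^^ k) ` \<Omega>\<^sub>1) \<epsilon> * rc \<iota>\<^sub>2 (\<Union>k<n. (\<alpha>\<^sub>2 ^^ k) ` \<Omega>\<^sub>2) \<epsilon>"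
      using rc_orbit_tensor[OF assms \<Omega>\<delta>] by blast
    define r where "r = (\<lambda>n. real (rc \<iota> (\<Union>k<n. (?\<beta> ^^ k) ` \<Omega>) \<delta>))"
    define r\<^sub>1 where "r\<^sub>1 = (\<lambda>n. real (rc \<iota>\<^sub>1 (\<Union>k<n. (\<alpha>\<^sub>1 ^^ k) ` \<Omega>\<^sub>1) \<epsilon>))"
    define r\<^sub>2 where "r\<^sub>2 = (\<lambda>n. real (rc \<iota>\<^sub>2 (\<Union>k<n. (\<alpha>\<^sub>2 ^^ k) ` \<Omega>\<^sub>2) \<epsilon>))"
    have pos: "0 < rc \<iota>\<^sub>1 (\<Union>k<n. (\<alpha>\<^sub>1 ^^ k) ` \<Omega>\<^sub>1) \<epsilon>" "0 < rc \<iota>\<^sub>2 (\<Union>k<n. (\<alpha>\<^sub>2 ^^ k) ` \<Omega>\<^sub>2) \<epsilon>" for n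
      using assms(3,4) fin \<epsilon> by (auto intro!: rc_pos)
    have step: "1 / real n * ln (r n) \<le> 1 / real n * ln (r\<^sub>1 n) + 1 / real n * ln (r\<^sub>2 n)" for n
      using mult_left_mono[OF ln_of_nat_le_add[OF le[of n] pos[of n]], of "1 / real n"]
      unfolding r_def r\<^sub>1_def r\<^sub>2_def distrib_left by simp
    have "hc_set_tol \<iota> ?\<beta> \<Omega> \<delta> = limsup (\<lambda>n. ereal (1 / real n * ln (r n)))"
      by (simp only: hc_set_tol_def r_def)
    also have "\<dots> \<le> limsup (\<lambda>n. ereal (1 / real n * ln (r\<^sub>1 n)) + ereal (1 / real n * ln (r\<^sub>2 n)))"
      using step by (intro Limsup_mono always_eventually) simp
    also have "\<dots> \<le> limsup (\<lambda>n. ereal (1 / real n * ln (r\<^sub>1 n))) + limsup (\<lambda>n. ereal (1 / real n * ln (r\<^sub>2 n)))"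
      by (rule ereal_limsup_add_mono)
    also have "\<dots> = hc_set_tol \<iota>\<^sub>1 \<alpha>\<^sub>1 \<Omega>\<^sub>1 \<epsilon> + hc_set_tol \<iota>\<^sub>2 \<alpha>\<^sub>2 \<Omega>\<^sub>2 \<epsilon>"
      by (simp only: hc_set_tol_def r\<^sub>1_def r\<^sub>2_def)
    also have "\<dots> \<le> hc \<iota>\<^sub>1 \<alpha>\<^sub>1 + hc \<iota>\<^sub>2 \<alpha>\<^sub>2"
      using fin \<epsilon> by (intro add_mono hc_set_tol_le_hc)
    finally show ?thesis .
  qed
  then show ?thesis
    unfolding hc_def[of \<iota>] hc_set_def[of \<iota>] by (intro SUP_least) auto
qed

end
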